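(* Let $\mathbb{K}$ be a field of characteristic $0$, let $q_+,q_-\in\mathbb{K}$ be non-zero and put $q=q_+q_-$. Let $p\in\mathbb{K}[z]$ be a non-zero polynomial with a root $0$ of multiplicity $k$. Then: (1) The $k$-th Veronese subalgebra $\mathcal{A}(p;q_\pm)^{(k)}$ of $\mathcal{A}(p;q_\pm)$ is a strongly $\mathbb{Z}$-graded algebra with the degree-zero part equal to $\mathcal{B}(p;q,0)$. (2) If $q$ is not a root of unity, then $\mathcal{A}(p;q_\pm)^{(k)}$ is a non-degenerate projectively graded algebra if and only if $p$ has at least one non-zero root.
   Context: All algebras are associative unital $\mathbb{K}$-algebras. For $q,r\in\mathbb{K}$, $q\neq 0$, and a non-zero polynomial $p\in\mathbb{K}[z]$, $\mathcal{B}(p;q,r)$ denotes the algebra generated by $x,y,z$ subject to the relations $$xy=p(qz+r),\quad yx=p(z),\quad xz=(qz+r)x,\quad yz=q^{-1}(z-r)y.$$ Given a non-zero $p$ with root $0$ of multiplicity $k$, write $p(z)=z^k\tilde p(z)$. For non-zero $q\in\mathbb{K}$ and $q_\pm\in\mathbb{K}$ with $q_+q_-=q$, $\mathcal{A}(p;q_\pm)$ denotes the algebra generated by $z_+,z_-,x_+,x_-$ subject to the relations $$z_+z_-=z_-z_+,\quad x_+x_-=\tilde p(z_+z_-),\quad x_-x_+=\tilde p(q z_+z_-),\quad x_+z_\pm=q_\pm^{-1}z_\pm x_+,\quad x_-z_\pm=q_\pm z_\pm x_-.$$ It is $\mathbb{Z}$-graded by $\deg z_\pm=\pm1$, $\deg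 x_\pm=\pm k$. Its $k$-th Veronese subalgebra is $\mathcal{A}(p;q_\pm)^{(k)}=\bigoplus_{n\in\mathbb{Z}}\mathcal{A}(p;q_\pm)_{nk}$, viewed as a $\mathbb{Z}$-graded algebra whose degree-$n$ component is $\mathcal{A}(p;q_\pm)_{nk}$. A $\mathbb{Z}$-graded algebra $\mathcal{A}=\bigoplus_{n\in\mathbb{Z}}\mathcal{A}_n$ is strongly graded if $\mathcal{A}_m\mathcal{A}_n=\mathcal{A}_{m+n}$ for all $m,n\in\mathbb{Z}$. It is projectively graded if, for all $n\in\mathbb{Z}$, $\mathcal{A}_n$ is a projective left $\mathcal{A}_0$-module. A projectively graded algebra is non-degenerate if (a) for all $n\in\mathbb{Z}\setminus\{0\}$, $\mathcal{A}_n$ is a finitely generated left $\mathcal{A}_0$-module, and (b) for all $m,n\in\mathbb{Z}$ with $m\neq n$, $\mathcal{A}_m\not\cong\mathcal{A}_n$ as left $\mathcal{A}_0$-modules.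
   Formalization: In (2), the non-zero root of p is taken in the algebraic closure of K; with roots in K only the claim fails, e.g. K = ℚ, q₊ = 2, q₋ = 1, p = z(z²+1), where the algebra is non-degenerate but p has no non-zero rational root. *)

theory Defs
  imports
    "HOL-Library.Poly_Mapping"
    "HOL-Algebra.Module"
    "HOL-Algebra.QuotRing"
    "HOL-Algebra.Ideal_Product"
    "HOL-Algebra.Algebraic_Closure_Type"
begin

section \<open>Algebras given by generators and relations\<close>

datatype 'g free_monoid = Word (letters: "'g list")

instantiation free_monoid :: (type) monoid_add
begin
definition zero_free_monoid :: "'a free_monoid" where "0 = Word []"
definition plus_free_monoid :: "'a free_monoid \<Rightarrow> 'a free_monoid \<Rightarrow> 'a free_monoid"
  where "u + v = Word (letters u @ letters v)"
instance
  by standard (auto simp: zero_free_monoid_def plus_free_monoid_def)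
end

text \<open>The free algebra on the generators \<open>'g\<close> is the monoid algebra of the free monoid:
  multiplication in \<^typ>\<open>'m \<Rightarrow>\<^sub>0 'k\<close> is convolution with respect to the (here noncommutative)
  addition of the index monoid.\<close>

type_synonym ('g, 'k) free_algebra = "'g free_monoid \<Rightarrow>\<^sub>0 'k"

definition gen :: "'g \<Rightarrow> ('g, 'k::field) free_algebra"
  where "gen g = Poly_Mapping.single (Word [g]) 1"

definition const :: "'k \<Rightarrow> ('g, 'k::field) free_algebra"
  where "const c = Poly_Mapping.single 0 c"

text \<open>The library's \<^const>\<open>poly\<close> evaluates in commutative rings only.\<close>

definition poly_at :: "'k::field poly \<Rightarrow> ('g, 'k) free_algebra \<Rightarrow> ('g, 'k) free_algebra"
  where "poly_at f a = (\<Sum>i\<le>Polynomial.degree f. const (Polynomial.coeff f i) * a ^ i)"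

text \<open>A relation \<open>l = r\<close> is encoded by the element \<open>l - r\<close>; \<^const>\<open>genideal\<close> is the generated
  two-sided ideal. Algebras are records \<^typ>\<open>('k, 'b) module\<close>, i.e. rings together with a
  scalar multiplication.\<close>

definition relation_ideal :: "('g, 'k::field) free_algebra set \<Rightarrow> ('g, 'k) free_algebra set"
  where "relation_ideal S = Idl\<^bsub>ring_of_type_algebra\<^esub> S"

definition presented_ring :: "('g, 'k::field) free_algebra set \<Rightarrow> ('g, 'k) free_algebra set ring"
  where "presented_ring S = ring_of_type_algebra Quot (relation_ideal S)"

definition residue :: "('g, 'k::field) free_algebra set \<Rightarrow> ('g, 'k) free_algebra
    \<Rightarrow> ('g, 'k) free_algebra set"
  where "residue S f = relation_ideal S +>\<^bsub>ring_of_type_algebra\<^esub> f"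

definition presented_algebra :: "('g, 'k::field) free_algebra set
    \<Rightarrow> ('k, ('g, 'k) free_algebra set) module"
  where "presented_algebra S =
    \<lparr>carrier = carrier (presented_ring S),
     monoid.mult = monoid.mult (presented_ring S),
     one = one (presented_ring S),
     ring.zero = ring.zero (presented_ring S),
     add = add (presented_ring S),
     module.smult = (\<lambda>c a. residue S (const c) \<otimes>\<^bsub>presented_ring S\<^esub> a)\<rparr>"

text \<open>The degree-\<open>n\<close> component when generator \<open>g\<close> is given degree \<open>d g\<close>: the image of the span
  of the words of degree \<open>n\<close>.\<close>

definition presented_component :: "('g \<Rightarrow> int) \<Rightarrow> ('g, 'k::field) free_algebra set \<Rightarrow> int
    \<Rightarrow> ('g, 'k) free_algebra set set"
  where "presented_component d S n =
    residue S ` {f. \<forall>w\<in>Poly_Mapping.keys f. (\<Sum>g\<leftarrow>letters w. d g) = n}"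


section \<open>The algebras \<open>\<B>(p; q, r)\<close> and \<open>\<A>(p; q\<^sub>\<plusminus>)\<close>\<close>

datatype B_gen = Bx | By | Bz

definition B_relations :: "'k::field poly \<Rightarrow> 'k \<Rightarrow> 'k \<Rightarrow> (B_gen, 'k) free_algebra set"
  where "B_relations p q r =
    (let x = gen Bx; y = gen By; z = gen Bz in
      {x * y - poly_at p (const q * z + const r),
       y * x - poly_at p z,
       x * z - (const q * z + const r) * x,
       y * z - const (inverse q) * (z - const r) * y})"

definition B_algebra :: "'k::field poly \<Rightarrow> 'k \<Rightarrow> 'k \<Rightarrow> ('k, (B_gen, 'k) free_algebra set) module"
  where "B_algebra p q r = presented_algebra (B_relations p q r)"

text \<open>\<open>p(z) = z\<^sup>k p_tilde(z)\<close>, where \<open>k\<close> is the multiplicity of the root \<open>0\<close>.\<close>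

definition p_tilde :: "'k::field poly \<Rightarrow> 'k poly"
  where "p_tilde p = p div [:0, 1:] ^ Polynomial.order 0 p"

lemma p_tilde_eq:
  assumes "p \<noteq> 0"
  shows "p = [:0, 1:] ^ Polynomial.order 0 p * p_tilde p"
  using Polynomial.order_1[of 0 p] by (simp add: p_tilde_def)

datatype A_gen = Azp | Azm | Axp | Axm

definition A_relations :: "'k::field poly \<Rightarrow> 'k \<Rightarrow> 'k \<Rightarrow> (A_gen, 'k) free_algebra set"
  where "A_relations p qp qm =
    (let zp = gen Azp; zm = gen Azm; xp = gen Axp; xm = gen Axm in
      {zp * zm - zm * zp,
       xp * xm - poly_at (p_tilde p) (zp * zm),
       xm * xp - poly_at (p_tilde p) (const (qp * qm) * (zp * zm)),
       xp * zp - const (inverse qp) * zp * xp,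
       xp * zm - const (inverse qm) * zm * xp,
       xm * zp - const qp * zp * xm,
       xm * zm - const qm * zm * xm})"

definition A_algebra :: "'k::field poly \<Rightarrow> 'k \<Rightarrow> 'k \<Rightarrow> ('k, (A_gen, 'k) free_algebra set) module"
  where "A_algebra p qp qm = presented_algebra (A_relations p qp qm)"

primrec A_degree :: "nat \<Rightarrow> A_gen \<Rightarrow> int" where
  "A_degree k Azp = 1"
| "A_degree k Azm = - 1"
| "A_degree k Axp = int k"
| "A_degree k Axm = - int k"

definition A_component :: "'k::field poly \<Rightarrow> 'k \<Rightarrow> 'k \<Rightarrow> int \<Rightarrow> (A_gen, 'k) free_algebra set set"
  where "A_component p qp qm =
    presented_component (A_degree (Polynomial.order 0 p)) (A_relations p qp qm)"


section \<open>Graded algebras\<close>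

text \<open>The library's locale \<^locale>\<open>algebra\<close> covers commutative algebras only.\<close>

locale unital_algebra = module R A + ring A
  for R :: "('k, 'r) ring_scheme" and A :: "('k, 'a, 'm) module_scheme" (structure) +
  assumes smult_mult_left:
      "\<lbrakk>c \<in> carrier R; a \<in> carrier A; b \<in> carrier A\<rbrakk> \<Longrightarrow> (c \<odot> a) \<otimes> b = c \<odot> (a \<otimes> b)"
    and smult_mult_right:
      "\<lbrakk>c \<in> carrier R; a \<in> carrier A; b \<in> carrier A\<rbrakk> \<Longrightarrow> a \<otimes> (c \<odot> b) = c \<odot> (a \<otimes> b)"

definition algebra_isomorphic ::
    "('k, 'r) ring_scheme \<Rightarrow> ('k, 'a, 'm) module_scheme \<Rightarrow> ('k, 'b, 'n) module_scheme \<Rightarrow> bool"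
  where "algebra_isomorphic R A B \<longleftrightarrow>
    (\<exists>h \<in> ring_iso A B. \<forall>c\<in>carrier R. \<forall>a\<in>carrier A. h (c \<odot>\<^bsub>A\<^esub> a) = c \<odot>\<^bsub>B\<^esub> h a)"

locale graded_algebra = unital_algebra R A
  for R :: "('k, 'r) ring_scheme" and A :: "('k, 'a, 'm) module_scheme" (structure) +
  fixes G :: "int \<Rightarrow> 'a set"
  assumes component_submodule: "submodule (G n) R A"
    and component_mult: "\<lbrakk>a \<in> G m; b \<in> G n\<rbrakk> \<Longrightarrow> a \<otimes> b \<in> G (m + n)"
    and decomposition: "a \<in> carrier A \<Longrightarrow>
      \<exists>!f. (\<forall>n. f n \<in> G n) \<and> finite {n. f n \<noteq> \<zero>} \<and> a = (\<Oplus>n\<in>{n. f n \<noteq> \<zero>}. f n)"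

text \<open>\<^const>\<open>ideal_prod\<close> of two additive subgroups is the set of finite sums of products.\<close>

locale strongly_graded_algebra = graded_algebra +
  assumes strong: "ideal_prod A (G m) (G n) = G (m + n)"

definition degree_zero_part :: "('k, 'a) module \<Rightarrow> (int \<Rightarrow> 'a set) \<Rightarrow> ('k, 'a) module"
  where "degree_zero_part A G = A\<lparr>carrier := G 0\<rparr>"

definition veronese_component :: "nat \<Rightarrow> (int \<Rightarrow> 'a set) \<Rightarrow> int \<Rightarrow> 'a set"
  where "veronese_component k G n = G (n * int k)"

definition veronese_algebra :: "nat \<Rightarrow> ('k, 'a) module \<Rightarrow> (int \<Rightarrow> 'a set) \<Rightarrow> ('k, 'a) module"
  where "veronese_algebra k A G =
    A\<lparr>carrier := {finsum A f N | f N. finite N \<and> (\<forall>n\<in>N. f n \<in> veronese_component k G n)}\<rparr>"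


text \<open>The \<open>k\<close>-th Veronese subalgebra of \<open>\<A>(p; q\<^sub>\<plusminus>)\<close> and its grading.\<close>

definition A_veronese ::
    "nat \<Rightarrow> 'k::field poly \<Rightarrow> 'k \<Rightarrow> 'k \<Rightarrow> ('k, (A_gen, 'k) free_algebra set) module"
  where "A_veronese k p qp qm = veronese_algebra k (A_algebra p qp qm) (A_component p qp qm)"

definition A_veronese_component ::
    "nat \<Rightarrow> 'k::field poly \<Rightarrow> 'k \<Rightarrow> 'k \<Rightarrow> int \<Rightarrow> (A_gen, 'k) free_algebra set set"
  where "A_veronese_component k p qp qm = veronese_component k (A_component p qp qm)"


section \<open>Left modules over noncommutative rings\<close>

text \<open>The library's locale \<^locale>\<open>module\<close> requires a commutative base ring. The fields
  \<^const>\<open>monoid.mult\<close> and \<^const>\<open>one\<close> of a record representing a module play no role. The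
  locale \<^locale>\<open>submodule\<close> makes no assumption on the ring and is usable as it is.\<close>

locale left_module = R?: ring R + M?: abelian_group M
  for R :: "('r, 's) ring_scheme" (structure) and M :: "('r, 'm, 't) module_scheme" (structure) +
  assumes left_smult_closed:
      "\<lbrakk>a \<in> carrier R; x \<in> carrier M\<rbrakk> \<Longrightarrow> a \<odot>\<^bsub>M\<^esub> x \<in> carrier M"
    and left_smult_l_distr:
      "\<lbrakk>a \<in> carrier R; b \<in> carrier R; x \<in> carrier M\<rbrakk> \<Longrightarrow>
        (a \<oplus>\<^bsub>R\<^esub> b) \<odot>\<^bsub>M\<^esub> x = a \<odot>\<^bsub>M\<^esub> x \<oplus>\<^bsub>M\<^esub> b \<odot>\<^bsub>M\<^esub> x"
    and left_smult_r_distr: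
      "\<lbrakk>a \<in> carrier R; x \<in> carrier M; y \<in> carrier M\<rbrakk> \<Longrightarrow>
        a \<odot>\<^bsub>M\<^esub> (x \<oplus>\<^bsub>M\<^esub> y) = a \<odot>\<^bsub>M\<^esub> x \<oplus>\<^bsub>M\<^esub> a \<odot>\<^bsub>M\<^esub> y"
    and left_smult_assoc:
      "\<lbrakk>a \<in> carrier R; b \<in> carrier R; x \<in> carrier M\<rbrakk> \<Longrightarrow>
        (a \<otimes>\<^bsub>R\<^esub> b) \<odot>\<^bsub>M\<^esub> x = a \<odot>\<^bsub>M\<^esub> (b \<odot>\<^bsub>M\<^esub> x)"
    and left_smult_one:
      "x \<in> carrier M \<Longrightarrow> \<one>\<^bsub>R\<^esub> \<odot>\<^bsub>M\<^esub> x = x"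

definition left_module_isomorphic ::
    "('r, 's) ring_scheme \<Rightarrow> ('r, 'm, 't) module_scheme \<Rightarrow> ('r, 'n, 'u) module_scheme \<Rightarrow> bool"
  where "left_module_isomorphic R M N \<longleftrightarrow>
    (\<exists>h. bij_betw h (carrier M) (carrier N) \<and>
      (\<forall>x\<in>carrier M. \<forall>y\<in>carrier M. h (x \<oplus>\<^bsub>M\<^esub> y) = h x \<oplus>\<^bsub>N\<^esub> h y) \<and>
      (\<forall>a\<in>carrier R. \<forall>x\<in>carrier M. h (a \<odot>\<^bsub>M\<^esub> x) = a \<odot>\<^bsub>N\<^esub> h x))"

definition finitely_generated_left_module ::
    "('r, 's) ring_scheme \<Rightarrow> ('r, 'm, 't) module_scheme \<Rightarrow> bool"
  where "finitely_generated_left_module R M \<longleftrightarrow> left_module R M \<and>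
    (\<exists>S. finite S \<and> S \<subseteq> carrier M \<and>
      (\<forall>x\<in>carrier M. \<exists>c \<in> S \<rightarrow> carrier R. x = (\<Oplus>\<^bsub>M\<^esub>s\<in>S. c s \<odot>\<^bsub>M\<^esub> s)))"

text \<open>The free left module on the index set \<open>I\<close>: finitely supported functions vanishing outside
  \<open>I\<close>.\<close>

definition free_left_module :: "('r, 's) ring_scheme \<Rightarrow> 'i set \<Rightarrow> ('r, 'i \<Rightarrow> 'r) module"
  where "free_left_module R I =
    \<lparr>carrier = {f. (\<forall>i. f i \<in> carrier R) \<and> (\<forall>i. i \<notin> I \<longrightarrow> f i = \<zero>\<^bsub>R\<^esub>) \<and> finite {i. f i \<noteq> \<zero>\<^bsub>R\<^esub>}},
     monoid.mult = undefined,
     one = undefined,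
     ring.zero = (\<lambda>i. \<zero>\<^bsub>R\<^esub>),
     add = (\<lambda>f g i. f i \<oplus>\<^bsub>R\<^esub> g i),
     module.smult = (\<lambda>a f i. a \<otimes>\<^bsub>R\<^esub> f i)\<rparr>"

text \<open>Projective means isomorphic to a direct summand of a free module. The basis may be taken
  inside the type \<open>'m\<close> of the module: a projective module is a direct summand of the free module
  on its own carrier.\<close>

definition projective_left_module ::
    "('r, 's) ring_scheme \<Rightarrow> ('r, 'm, 't) module_scheme \<Rightarrow> bool"
  where "projective_left_module R M \<longleftrightarrow> left_module R M \<and>
    (\<exists>(I :: 'm set) P Q.
      submodule P R (free_left_module R I) \<and>
      submodule Q R (free_left_module R I) \<and>
      P \<inter> Q = {\<zero>\<^bsub>free_left_module R I\<^esub>} \<and>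
      P <+>\<^bsub>free_left_module R I\<^esub> Q = carrier (free_left_module R I) \<and>
      left_module_isomorphic R M ((free_left_module R I)\<lparr>carrier := P\<rparr>))"


section \<open>Non-degenerate projectively graded algebras\<close>

text \<open>The component \<open>G n\<close> as a left module over the degree-zero part, acting by multiplication.\<close>

definition component_module :: "('k, 'a) module \<Rightarrow> (int \<Rightarrow> 'a set) \<Rightarrow> int \<Rightarrow> ('a, 'a) module"
  where "component_module A G n =
    \<lparr>carrier = G n,
     monoid.mult = undefined,
     one = undefined,
     ring.zero = \<zero>\<^bsub>A\<^esub>,
     add = add A,
     module.smult = monoid.mult A\<rparr>"

definition projectively_graded_algebra ::
    "('k, 'r) ring_scheme \<Rightarrow> ('k, 'a) module \<Rightarrow> (int \<Rightarrow> 'a set) \<Rightarrow> bool"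
  where "projectively_graded_algebra R A G \<longleftrightarrow> graded_algebra R A G \<and>
    (\<forall>n. projective_left_module (degree_zero_part A G) (component_module A G n))"

definition nondegenerate_projectively_graded_algebra ::
    "('k, 'r) ring_scheme \<Rightarrow> ('k, 'a) module \<Rightarrow> (int \<Rightarrow> 'a set) \<Rightarrow> bool"
  where "nondegenerate_projectively_graded_algebra R A G \<longleftrightarrow>
    projectively_graded_algebra R A G \<and>
    (\<forall>n. n \<noteq> 0 \<longrightarrow>
      finitely_generated_left_module (degree_zero_part A G) (component_module A G n)) \<and>
    (\<forall>m n. m \<noteq> n \<longrightarrow>
      \<not> left_module_isomorphic (degree_zero_part A G) (component_module A G m)
          (component_module A G n))"


section \<open>Roots\<close>

text \<open>Roots of a polynomial over an arbitrary field \<open>'k\<close> are understood to lie in the algebraic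
  closure. Over a field that is not algebraically closed, the roots in \<open>'k\<close> itself are not
  enough: \<open>z * (z\<^sup>2 + 1)\<close> has no non-zero rational root.\<close>

definition has_nonzero_root :: "'k::field poly \<Rightarrow> bool"
  where "has_nonzero_root p \<longleftrightarrow>
    (\<exists>w :: 'k alg_closure. w \<noteq> 0 \<and> poly (map_poly to_ac p) w = 0)"

lemma map_poly_to_ac_mult:
  "map_poly to_ac (p * q) = map_poly to_ac p * map_poly to_ac (q :: 'k::field poly)"
  by (rule poly_eqI) (simp add: coeff_map_poly coeff_mult to_ac_sum)

lemma map_poly_to_ac_1: "map_poly to_ac (1 :: 'k::field poly) = 1"
  by (rule poly_eqI) (simp add: coeff_map_poly)

lemma poly_map_poly_to_ac:
  "poly (map_poly to_ac p) (to_ac w) = to_ac (poly p (w :: 'k::field))"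
  by (induction p) (auto simp: map_poly_pCons)

lemma has_nonzero_root_alg_closed:
  fixes p :: "'k::alg_closed_field poly"
  assumes "p \<noteq> 0"
  shows "has_nonzero_root p \<longleftrightarrow> (\<exists>w. w \<noteq> 0 \<and> poly p w = 0)"
proof
  assume "\<exists>w. w \<noteq> 0 \<and> poly p w = 0"
  then show "has_nonzero_root p"
    unfolding has_nonzero_root_def by (metis poly_map_poly_to_ac to_ac_0 to_ac_eq_iff)
next
  assume "has_nonzero_root p"
  then obtain w :: "'k alg_closure" where w: "w \<noteq> 0" "poly (map_poly to_ac p) w = 0"
    unfolding has_nonzero_root_def by blast
  obtain A where A: "p = Polynomial.smult (lead_coeff p) (\<Prod>x\<in>#A. [:- x, 1:])"
    using alg_closed_imp_factorization[OF assms] by blast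
  then have "p = [:lead_coeff p:] * (\<Prod>x\<in>#A. [:- x, 1:])" by simp
  then have "map_poly to_ac p =
      map_poly to_ac [:lead_coeff p:] * map_poly to_ac (\<Prod>x\<in>#A. [:- x, 1:])"
    by (metis map_poly_to_ac_mult)
  then have "poly (map_poly to_ac (\<Prod>x\<in>#A. [:- x, 1:])) w = 0"
    using w(2) assms by (auto simp: map_poly_pCons)
  moreover have "\<exists>x\<in>#A. to_ac x = w"
    if "poly (map_poly to_ac (\<Prod>x\<in>#A. [:- x, 1:])) w = 0" for A :: "'k multiset"
    using that
  proof (induction A)
    case empty
    then show ?case by (simp add: map_poly_to_ac_1)
  next
    case (add x A)
    then have "poly (map_poly to_ac [:- x, 1:]) w = 0 \<or>
        poly (map_poly to_ac (\<Prod>x\<in>#A. [:- x, 1:])) w = 0"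
      by (simp only: image_mset_add_mset prod_mset.add_mset map_poly_to_ac_mult poly_mult
          mult_eq_0_iff)
    with add.IH show ?case by (auto simp: map_poly_pCons)
  qed
  ultimately obtain x where x: "x \<in># A" "to_ac x = w" by blast
  have "poly p x = 0"
    by (subst A) (use x(1) in \<open>auto simp: poly_prod_mset\<close>)
  with x w(1) show "\<exists>w. w \<noteq> 0 \<and> poly p w = 0" by auto
qed

end

theory Submission
  imports Defs "HOL-Library.Function_Algebras"
begin

text \<open>Put \<open>w = z\<^sub>+z\<^sub>-\<close>, write \<open>P\<close> for the polynomial obtained from \<open>p\<close> by dividing out \<open>z\<^sup>k\<close>, so
  that \<open>P(0) \<noteq> 0\<close>, and let \<open>A\<close> be \<open>\<A>(p; q\<^sub>\<plusminus>)\<close>.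

  Structure of \<open>A\<close>. All generators commute with \<open>z\<^sub>+\<close>, \<open>z\<^sub>-\<close> and \<open>w\<close> up to scalars, and
  \<open>x\<^sub>+x\<^sub>-\<close>, \<open>x\<^sub>-x\<^sub>+\<close> are polynomials in \<open>w\<close>. Hence every word of degree \<open>d\<close> reduces to
  \<open>f(w) e\<close>, where \<open>f\<close> is a polynomial and \<open>e\<close> a power of \<open>z\<^sub>+\<close> or \<open>z\<^sub>-\<close> times a power of
  \<open>x\<^sub>+\<close> or \<open>x\<^sub>-\<close>; there is one such \<open>e\<close> for each degree \<open>n\<close> in \<open>x\<^sub>\<plusminus>\<close> (\<open>A_normal_form\<close>). A
  representation of \<open>A\<close> on two-sided series over \<open>\<K>[w]\<close> shows that these elements are
  independent over \<open>\<K>[w]\<close> (\<open>A_basis_independent\<close>). The degree-zero part is then freely spanned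
  over \<open>\<K>[w]\<close> by the powers of \<open>z\<^sub>-\<^sup>kx\<^sub>+\<close> and of \<open>z\<^sub>+\<^sup>kx\<^sub>-\<close>. These two elements and \<open>w\<close> satisfy,
  after rescaling one of them, the relations of \<open>\<B>(p; q, 0)\<close>, whose words have the same normal
  forms; so substituting them for \<open>y\<close>, \<open>x\<close> and \<open>z\<close> is an isomorphism.

  Strong grading. For every \<open>m\<close> the product \<open>x\<^sub>+\<^sup>mx\<^sub>-\<^sup>m\<close> is \<open>Q(w)\<close> with \<open>Q(0) = P(0)\<^sup>m \<noteq> 0\<close>, while
  \<open>z\<^sub>+\<^sup>N z\<^sub>-\<^sup>N = w\<^sup>N\<close>. As \<open>Q\<close> is coprime to every power of the variable, a Bezout identity writes
  \<open>1\<close> as a sum of two products from \<open>A\<^sub>m\<^sub>k A\<^sub>-\<^sub>m\<^sub>k\<close>; similarly for negative degrees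
  (\<open>graded_partition_of_unity_V\<close>). Such a partition of unity makes the grading strong, and its
  factors are dual bases, so the components are always finitely generated and projective.

  Non-degeneracy. The partition of unity also shows that a left-linear map between two components
  is right multiplication by an element of \<open>A\<close>. So two components are isomorphic if and only if
  the difference of their degrees is the degree of a homogeneous unit. If \<open>p\<close> has no non-zero
  root, then \<open>P\<close> is constant and \<open>x\<^sub>+\<close> is a unit of degree \<open>k\<close>. If \<open>P\<close> is not constant, let
  \<open>u\<close> be a homogeneous unit of degree \<open>d\<close>. Comparing highest and lowest degrees in \<open>x\<^sub>\<plusminus>\<close>
  shows that \<open>u\<close> and its inverse each have a single normal form term. In the representation
  both terms have polynomial coefficients, whose product is \<open>1\<close> after a rescaling of \<open>w\<close> in one of
  them; so both coefficients are constant. For \<open>u\<close> this coefficient contains the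
  factor \<open>P\<close> if \<open>n > 0\<close>, and a power of \<open>w\<close> if \<open>nk > d\<close>, where \<open>n\<close> is the degree of the term in
  \<open>x\<^sub>\<plusminus>\<close>; for the inverse \<open>n\<close> and \<open>d\<close> change sign. So \<open>n = 0\<close> and \<open>d = 0\<close>
  (\<open>homogeneous_unit_degree\<close>).\<close>


section \<open>Quotients of free algebras\<close>

lemma free_algebra_induct [case_names zero add]:
  assumes "P 0" and "\<And>k c f. P f \<Longrightarrow> P (Poly_Mapping.single k c + f)"
  shows "P (f :: 'a \<Rightarrow>\<^sub>0 'b::comm_monoid_add)"
proof (induction f rule: update_induct)
  case (update p k c)
  have "Poly_Mapping.update k c p = Poly_Mapping.single k c + p"
    by (rule poly_mapping_eqI)
      (use update.hyps(1) in \<open>auto simp: lookup_update lookup_add lookup_single when_def in_keys_iff\<close>)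
  with assms(2)[OF update.IH] show ?case by simp
qed (use assms(1) in simp)

lemma ring_of_type_algebra_simps:
  "carrier ring_of_type_algebra = UNIV"
  "x \<otimes>\<^bsub>ring_of_type_algebra\<^esub> y = x * y"
  "x \<oplus>\<^bsub>ring_of_type_algebra\<^esub> y = x + y"
  "\<one>\<^bsub>ring_of_type_algebra\<^esub> = 1"
  "\<zero>\<^bsub>ring_of_type_algebra\<^esub> = 0"
  by (simp_all add: ring_of_type_algebra_def)

lemma ring_ring_of_type_algebra: "ring (ring_of_type_algebra :: 'a::ring_1 ring)"
proof (rule ringI)
  show "abelian_group (ring_of_type_algebra :: 'a ring)"
  proof (rule abelian_groupI)
    show "\<exists>y\<in>carrier ring_of_type_algebra. y \<oplus>\<^bsub>ring_of_type_algebra\<^esub> x = \<zero>\<^bsub>ring_of_type_algebra\<^esub>"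
      for x :: 'a
      by (rule bexI[of _ "- x"]) (simp_all add: ring_of_type_algebra_simps)
  qed (simp_all add: ring_of_type_algebra_simps ac_simps)
  show "Group.monoid (ring_of_type_algebra :: 'a ring)"
    by (rule monoidI) (simp_all add: ring_of_type_algebra_simps mult.assoc)
qed (simp_all add: ring_of_type_algebra_simps distrib_left distrib_right)

lemma ideal_relation_ideal: "ideal (relation_ideal S) ring_of_type_algebra"
  unfolding relation_ideal_def
  by (rule ring.genideal_ideal[OF ring_ring_of_type_algebra]) (simp add: ring_of_type_algebra_simps)

lemma relation_ideal_0: "0 \<in> relation_ideal S"
  using additive_subgroup.zero_closed[OF ideal.axioms(1)[OF ideal_relation_ideal[of S]]]
  by (simp add: ring_of_type_algebra_simps)

lemma relation_ideal_add:
  "f \<in> relation_ideal S \<Longrightarrow> g \<in> relation_ideal S \<Longrightarrow> f + g \<in> relation_ideal S"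
  using additive_subgroup.a_closed[OF ideal.axioms(1)[OF ideal_relation_ideal[of S]], of f g]
  by (simp add: ring_of_type_algebra_simps)

lemma relation_ideal_mult_left: "f \<in> relation_ideal S \<Longrightarrow> g * f \<in> relation_ideal S"
  using ideal.I_l_closed[OF ideal_relation_ideal[of S], of f g]
  by (simp add: ring_of_type_algebra_simps)

lemma relation_ideal_mult_right: "f \<in> relation_ideal S \<Longrightarrow> f * g \<in> relation_ideal S"
  using ideal.I_r_closed[OF ideal_relation_ideal[of S], of f g]
  by (simp add: ring_of_type_algebra_simps)

lemma relation_ideal_uminus: "f \<in> relation_ideal S \<Longrightarrow> - f \<in> relation_ideal S"
  using relation_ideal_mult_left[of f S "- 1"] by simp

lemma relation_ideal_diff:
  "f \<in> relation_ideal S \<Longrightarrow> g \<in> relation_ideal S \<Longrightarrow> f - g \<in> relation_ideal S"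
  using relation_ideal_add[of f S "- g"] relation_ideal_uminus[of g S] by simp

lemma relation_ideal_generator: "f \<in> S \<Longrightarrow> f \<in> relation_ideal S"
  unfolding relation_ideal_def
  using ring.genideal_self[OF ring_ring_of_type_algebra, of S] by (auto simp: ring_of_type_algebra_simps)

lemma relation_ideal_subset:
  assumes "S \<subseteq> J" "0 \<in> J" "\<And>f g. f \<in> J \<Longrightarrow> g \<in> J \<Longrightarrow> f + g \<in> J"
    and "\<And>f g. f \<in> J \<Longrightarrow> g * f \<in> J" "\<And>f g. f \<in> J \<Longrightarrow> f * g \<in> J"
  shows "relation_ideal S \<subseteq> J"
  unfolding relation_ideal_def
proof (rule ring.genideal_minimal[OF ring_ring_of_type_algebra])
  interpret R: ring "ring_of_type_algebra :: ('a, 'b) free_algebra ring"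
    by (rule ring_ring_of_type_algebra)
  have "- f \<in> J" if "f \<in> J" for f
    using assms(4)[OF that, of "- 1"] by simp
  moreover have "inv\<^bsub>add_monoid ring_of_type_algebra\<^esub> f = - f" for f :: "('a, 'b) free_algebra"
    using R.minus_equality[of "- f" f] unfolding a_inv_def by (simp only: ring_of_type_algebra_simps) simp
  ultimately show "ideal J ring_of_type_algebra"
    using assms by (intro idealI R.ring_axioms) (auto simp: subgroup_def ring_of_type_algebra_simps)
qed (use assms in auto)

lemma residue_eq_iff: "residue S f = residue S g \<longleftrightarrow> f - g \<in> relation_ideal S"
proof -
  have residue: "residue S f = (\<lambda>h. h + f) ` relation_ideal S" for f
    by (auto simp: residue_def a_r_coset_defs ring_of_type_algebra_simps)
  show ?thesis
  proof
    assume eq: "residue S f = residue S g"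
    have "f \<in> residue S f"
      unfolding residue using relation_ideal_0 by force
    then show "f - g \<in> relation_ideal S"
      unfolding eq unfolding residue by auto
  next
    assume fg: "f - g \<in> relation_ideal S"
    have "h + f \<in> residue S g" if "h \<in> relation_ideal S" for h
      using relation_ideal_add[OF that fg] unfolding residue by (auto simp: image_iff intro!: bexI[of _ "h + (f - g)"])
    moreover have "h + g \<in> residue S f" if "h \<in> relation_ideal S" for h
      using relation_ideal_diff[OF that fg] unfolding residue by (auto simp: image_iff intro!: bexI[of _ "h - (f - g)"])
    ultimately show "residue S f = residue S g"
      unfolding residue by blast
  qed
qed

lemma presented_algebra_simps:
  "carrier (presented_algebra S) = range (residue S)"
  "residue S f \<otimes>\<^bsub>presented_algebra S\<^esub> residue S g = residue S (f * g)"
  "residue S f \<oplus>\<^bsub>presented_algebra S\<^esub> residue S g = residue S (f + g)"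
  "\<one>\<^bsub>presented_algebra S\<^esub> = residue S 1"
  "\<zero>\<^bsub>presented_algebra S\<^esub> = residue S 0"
  "c \<odot>\<^bsub>presented_algebra S\<^esub> residue S f = residue S (const c * f)"
proof -
  interpret I: ideal "relation_ideal S" ring_of_type_algebra by (rule ideal_relation_ideal)
  have mult: "residue S f \<otimes>\<^bsub>presented_ring S\<^esub> residue S g = residue S (f * g)" for f g
    using I.rcoset_mult_add[of f g]
    by (simp add: presented_ring_def FactRing_def residue_def ring_of_type_algebra_simps)
  then show "residue S f \<otimes>\<^bsub>presented_algebra S\<^esub> residue S g = residue S (f * g)"
    and "c \<odot>\<^bsub>presented_algebra S\<^esub> residue S f = residue S (const c * f)"
    by (simp_all add: presented_algebra_def)
  show "carrier (presented_algebra S) = range (residue S)"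
    by (auto simp: presented_algebra_def presented_ring_def FactRing_def A_RCOSETS_defs
        residue_def ring_of_type_algebra_simps a_r_coset_def r_coset_def)
  show "residue S f \<oplus>\<^bsub>presented_algebra S\<^esub> residue S g = residue S (f + g)"
    using I.a_rcos_sum[of f g]
    by (simp add: presented_algebra_def presented_ring_def FactRing_def residue_def
        ring_of_type_algebra_simps)
  show "\<one>\<^bsub>presented_algebra S\<^esub> = residue S 1"
    by (simp add: presented_algebra_def presented_ring_def FactRing_def residue_def
        ring_of_type_algebra_simps)
  show "\<zero>\<^bsub>presented_algebra S\<^esub> = residue S 0"
    by (auto simp add: presented_algebra_def presented_ring_def FactRing_def residue_def
        a_r_coset_defs ring_of_type_algebra_simps)
qed

lemma residue_mult_cong:
  assumes "residue S f = residue S f'" "residue S g = residue S g'"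
  shows "residue S (f * g) = residue S (f' * g')"
  using assms by (simp flip: presented_algebra_simps(2))

lemma residue_add_cong:
  assumes "residue S f = residue S f'" "residue S g = residue S g'"
  shows "residue S (f + g) = residue S (f' + g')"
  using assms by (simp flip: presented_algebra_simps(3))

lemma residue_sum_cong:
  assumes "\<And>n. n \<in> N \<Longrightarrow> residue S (F n) = residue S (F' n)"
  shows "residue S (\<Sum>n\<in>N. F n) = residue S (\<Sum>n\<in>N. F' n)"
  using assms by (induction N rule: infinite_finite_induct) (auto intro!: residue_add_cong)

lemma const_simps:
  "const 0 = 0" "const 1 = 1" "const (a + b) = const a + const b" "const (a * b) = const a * const b"
  "const (- a) = - const a"
  by (simp_all add: const_def single_add mult_single single_uminus)

lemma const_commute: "const c * f = f * const c"
proof (induction f rule: free_algebra_induct)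
  case (add w d f)
  then show ?case by (simp add: const_def distrib_left distrib_right mult_single mult.commute)
qed simp

lemma mult_const_left_commute: "f * (const c * g) = const c * (f * g)"
  by (metis const_commute mult.assoc)

lemma const_mult_eq_1: "c \<noteq> 0 \<Longrightarrow> const (inverse c) * const c = 1"
  by (simp add: const_simps(4)[symmetric] const_simps(2))

lemma const_mult_inverse_cancel: "c \<noteq> 0 \<Longrightarrow> const c * (const (inverse c) * f) = f"
  by (simp add: const_mult_eq_1[of "inverse c", simplified] flip: mult.assoc)

text \<open>Every algebra of the statement is a set of residues of a subalgebra of the free algebra:
  the presented algebras, the Veronese subalgebra and its degree-zero part.\<close>

abbreviation residue_algebra ::
    "('g, 'k::field) free_algebra set \<Rightarrow> ('g, 'k) free_algebra set
      \<Rightarrow> ('k, ('g, 'k) free_algebra set) module"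
  where "residue_algebra S C \<equiv> (presented_algebra S)\<lparr>carrier := residue S ` C\<rparr>"

lemma unital_algebra_residue_algebra:
  assumes C: "0 \<in> C" "1 \<in> C" "\<And>f g. f \<in> C \<Longrightarrow> g \<in> C \<Longrightarrow> f + g \<in> C"
    "\<And>f g. f \<in> C \<Longrightarrow> g \<in> C \<Longrightarrow> f * g \<in> C" "\<And>c. const c \<in> C"
  shows "unital_algebra ring_of_type_algebra (residue_algebra S C)"
proof -
  note simps = presented_algebra_simps ring_of_type_algebra_simps
  let ?V = "residue_algebra S C"
  have inverse: "- f \<in> C" if "f \<in> C" for f
    using C(4)[OF C(5)[of "- 1"] that] by (simp only: const_simps) simp
  have "abelian_group ?V"
  proof (rule abelian_groupI)
    fix x assume "x \<in> carrier ?V"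
    then obtain f where "f \<in> C" "x = residue S f" by auto
    then show "\<exists>y\<in>carrier ?V. y \<oplus>\<^bsub>?V\<^esub> x = \<zero>\<^bsub>?V\<^esub>"
      by (intro bexI[of _ "residue S (- f)"]) (auto simp: simps inverse)
  qed (use C in \<open>auto simp: simps ac_simps\<close>)
  moreover from this have "ring ?V"
    by (intro ringI monoidI) (use C in \<open>auto simp: simps algebra_simps\<close>)
  moreover have "module ring_of_type_algebra ?V"
    by (intro moduleI cring_from_type_algebra calculation(1))
      (use C in \<open>auto simp: simps algebra_simps const_simps\<close>)
  ultimately show ?thesis
    by (intro unital_algebra.intro unital_algebra_axioms.intro)
      (auto simp: presented_algebra_simps mult.assoc mult_const_left_commute)
qed

lemma residue_algebra_UNIV: "residue_algebra S UNIV = presented_algebra S"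
  by (simp add: presented_algebra_def presented_algebra_simps(1)[symmetric])

lemma unital_algebra_presented_algebra: "unital_algebra ring_of_type_algebra (presented_algebra S)"
  using unital_algebra_residue_algebra[of UNIV S] by (simp add: residue_algebra_UNIV)

text \<open>The value of \<^const>\<open>finsum\<close> involves the carrier, so the sums in a subalgebra, in its
  components and in the whole algebra have to be identified through this rule.\<close>

lemma finsum_residue:
  assumes M: "abelian_monoid M" "add M = add (presented_algebra S)" "\<zero>\<^bsub>M\<^esub> = residue S 0"
    and N: "finite N" "\<And>n. n \<in> N \<Longrightarrow> residue S (F n) \<in> carrier M"
  shows "finsum M (\<lambda>n. residue S (F n)) N = residue S (\<Sum>n\<in>N. F n)"
  using N
proof (induction N rule: finite_induct)
  case empty
  then show ?case by (simp add: abelian_monoid.finsum_empty[OF M(1)] M(3))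
next
  case (insert n N)
  then show ?case
    by (subst abelian_monoid.finsum_insert[OF M(1)])
      (auto simp: M(2) presented_algebra_simps)
qed


section \<open>Representations of free algebras\<close>

locale free_algebra_action = vector_space scale
  for scale :: "'k::field \<Rightarrow> 'v::ab_group_add \<Rightarrow> 'v" +
  fixes gen_op :: "'g \<Rightarrow> 'v \<Rightarrow> 'v"
  assumes gen_op_add: "gen_op g (u + v) = gen_op g u + gen_op g v"
    and gen_op_scale: "gen_op g (scale c v) = scale c (gen_op g v)"
begin

definition act :: "('g, 'k) free_algebra \<Rightarrow> 'v \<Rightarrow> 'v"
  where "act f v = (\<Sum>w\<in>Poly_Mapping.keys f.
    scale (Poly_Mapping.lookup f w) (foldr gen_op (letters w) v))"

lemma word_op_add: "foldr gen_op ws (u + v) = foldr gen_op ws u + foldr gen_op ws v"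
  by (induction ws) (simp_all add: gen_op_add)

lemma word_op_scale: "foldr gen_op ws (scale c v) = scale c (foldr gen_op ws v)"
  by (induction ws) (simp_all add: gen_op_scale)

lemma act_zero [simp]: "act 0 v = 0"
  by (simp add: act_def)

lemma act_add: "act (f + g) v = act f v + act g v"
  unfolding act_def by (rule setsum_keys_plus_distrib) (simp_all add: scale_left_distrib)

lemma act_sum: "act (\<Sum>n\<in>N. F n) v = (\<Sum>n\<in>N. act (F n) v)"
  by (induction N rule: infinite_finite_induct) (simp_all add: act_add)

lemma act_minus: "act (f - g) v = act f v - act g v"
  using act_add[of "f - g" g v] by (simp add: algebra_simps)

lemma act_single: "act (Poly_Mapping.single w c) v = scale c (foldr gen_op (letters w) v)"
  by (simp add: act_def)

lemma act_add_right: "act f (u + v) = act f u + act f v"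
  by (simp add: act_def word_op_add scale_right_distrib sum.distrib)

lemma act_zero_right [simp]: "act f 0 = 0"
  using act_add_right[of f 0 0] by simp

lemma act_sum_right: "act f (\<Sum>n\<in>N. V n) = (\<Sum>n\<in>N. act f (V n))"
  by (induction N rule: infinite_finite_induct) (simp_all add: act_add_right)

lemma act_mult: "act (f * g) v = act f (act g v)"
proof (induction f rule: free_algebra_induct)
  case (add w c f)
  have "act (Poly_Mapping.single w c * g) v = act (Poly_Mapping.single w c) (act g v)"
    by (induction g rule: free_algebra_induct)
      (simp_all add: act_add act_add_right act_single mult_single distrib_left
        plus_free_monoid_def word_op_scale)
  with add show ?case by (simp add: distrib_right act_add)
qed simp

lemma act_gen [simp]: "act (gen g) v = gen_op g v"
  by (simp add: gen_def act_single)

lemma act_const [simp]: "act (const c) v = scale c v"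
  by (simp add: const_def act_single zero_free_monoid_def)

lemma act_one [simp]: "act 1 v = v"
  using act_const[of 1 v] by (simp add: const_simps)

text \<open>The elements that send everything into a subspace \<open>U\<close> stable under the generators form a
  two-sided ideal, so it suffices to check the relations. With \<open>U = 0\<close> this gives representations
  of the presented algebra; with the relation ideal of another presentation it gives homomorphisms.\<close>

lemma act_relation_ideal:
  assumes U: "0 \<in> U" "\<And>u v. u \<in> U \<Longrightarrow> v \<in> U \<Longrightarrow> u + v \<in> U" "\<And>c u. u \<in> U \<Longrightarrow> scale c u \<in> U"
    "\<And>g u. u \<in> U \<Longrightarrow> gen_op g u \<in> U"
    and S: "\<And>s v. s \<in> S \<Longrightarrow> act s v \<in> U" and f: "f \<in> relation_ideal S"
  shows "act f v \<in> U"
proof -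
  have word: "foldr gen_op ws u \<in> U" if "u \<in> U" for ws u
    using that by (induction ws) (auto intro: U)
  have stable: "act g u \<in> U" if "u \<in> U" for g u
    by (induction g rule: free_algebra_induct) (auto simp: act_add act_single intro: U word that)
  have "relation_ideal S \<subseteq> {f. \<forall>v. act f v \<in> U}"
    by (rule relation_ideal_subset) (auto simp: act_add act_mult intro: U S stable)
  with f show ?thesis by blast
qed

end


section \<open>Gradings of presented algebras\<close>

abbreviation word_degree :: "('g \<Rightarrow> int) \<Rightarrow> 'g free_monoid \<Rightarrow> int"
  where "word_degree d w \<equiv> (\<Sum>g\<leftarrow>letters w. d g)"

lemma word_degree_plus: "word_degree d (u + v) = word_degree d u + word_degree d v"
  by (simp add: plus_free_monoid_def)

definition homogeneous :: "('g \<Rightarrow> int) \<Rightarrow> int \<Rightarrow> ('g, 'k::field) free_algebra set"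
  where "homogeneous d n = {f. \<forall>w\<in>Poly_Mapping.keys f. word_degree d w = n}"

lemma presented_component_eq: "presented_component d S n = residue S ` homogeneous d n"
  by (simp add: presented_component_def homogeneous_def)

lemma homogeneous_zero: "0 \<in> homogeneous d n"
  by (simp add: homogeneous_def)

lemma homogeneous_add: "f \<in> homogeneous d n \<Longrightarrow> g \<in> homogeneous d n \<Longrightarrow> f + g \<in> homogeneous d n"
  using keys_add[of f g] by (auto simp: homogeneous_def)

lemma homogeneous_mult:
  "f \<in> homogeneous d m \<Longrightarrow> g \<in> homogeneous d n \<Longrightarrow> f * g \<in> homogeneous d (m + n)"
  using keys_mult[of f g] by (fastforce simp: homogeneous_def word_degree_plus)

lemma homogeneous_const: "const c \<in> homogeneous d 0"
  by (simp add: homogeneous_def const_def zero_free_monoid_def)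

lemma homogeneous_gen: "d g = n \<Longrightarrow> gen g \<in> homogeneous d n"
  by (simp add: homogeneous_def gen_def)

lemma homogeneous_scale: "f \<in> homogeneous d n \<Longrightarrow> const c * f \<in> homogeneous d n"
  using homogeneous_mult[OF homogeneous_const] by fastforce

lemma homogeneous_uminus: "f \<in> homogeneous d n \<Longrightarrow> - f \<in> homogeneous d n"
  by (simp add: homogeneous_def)

lemma homogeneous_diff:
  "f \<in> homogeneous d n \<Longrightarrow> g \<in> homogeneous d n \<Longrightarrow> f - g \<in> homogeneous d n"
  using homogeneous_add[OF _ homogeneous_uminus, of f d n g] by simp

lemma homogeneous_one: "1 \<in> homogeneous d 0"
  using homogeneous_const[of 1 d] by (simp add: const_simps)

lemma homogeneous_power: "f \<in> homogeneous d m \<Longrightarrow> f ^ n \<in> homogeneous d (int n * m)"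
  by (induction n) (auto simp: homogeneous_one algebra_simps intro: homogeneous_mult)

lemma homogeneous_sum:
  "(\<And>i. i \<in> I \<Longrightarrow> F i \<in> homogeneous d n) \<Longrightarrow> (\<Sum>i\<in>I. F i) \<in> homogeneous d n"
  by (induction I rule: infinite_finite_induct) (auto simp: homogeneous_zero homogeneous_add)

lemma homogeneous_poly_at: "f \<in> homogeneous d 0 \<Longrightarrow> poly_at p f \<in> homogeneous d 0"
  unfolding poly_at_def using homogeneous_power[of f d 0]
  by (intro homogeneous_sum homogeneous_scale) simp

definition homogeneous_part ::
    "('g \<Rightarrow> int) \<Rightarrow> int \<Rightarrow> ('g, 'k::field) free_algebra \<Rightarrow> ('g, 'k) free_algebra"
  where "homogeneous_part d n f =
    Poly_Mapping.mapp (\<lambda>w c. if word_degree d w = n then c else 0) f"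

lemma lookup_homogeneous_part: "Poly_Mapping.lookup (homogeneous_part d n f) w =
    (if word_degree d w = n then Poly_Mapping.lookup f w else 0)"
  by (simp add: homogeneous_part_def lookup_mapp when_def in_keys_iff)

lemma homogeneous_part_zero [simp]: "homogeneous_part d n 0 = 0"
  by (rule poly_mapping_eqI) (simp add: lookup_homogeneous_part)

lemma homogeneous_part_add:
  "homogeneous_part d n (f + g) = homogeneous_part d n f + homogeneous_part d n g"
  by (rule poly_mapping_eqI) (simp add: lookup_homogeneous_part lookup_add)

lemma homogeneous_part_sum:
  "homogeneous_part d n (\<Sum>i\<in>I. F i) = (\<Sum>i\<in>I. homogeneous_part d n (F i))"
  by (induction I rule: infinite_finite_induct) (simp_all add: homogeneous_part_add)

lemma homogeneous_part_in: "homogeneous_part d n f \<in> homogeneous d n"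
  by (auto simp: homogeneous_def in_keys_iff lookup_homogeneous_part split: if_splits)

lemma homogeneous_part_homogeneous:
  "f \<in> homogeneous d m \<Longrightarrow> homogeneous_part d n f = (if n = m then f else 0)"
  by (rule poly_mapping_eqI) (auto simp: lookup_homogeneous_part homogeneous_def in_keys_iff)

lemma homogeneous_part_single:
  "homogeneous_part d n (Poly_Mapping.single w c) =
    (if word_degree d w = n then Poly_Mapping.single w c else 0)"
  by (rule poly_mapping_eqI) (auto simp: lookup_homogeneous_part lookup_single when_def)

lemma homogeneous_part_single_mult:
  "homogeneous_part d n (Poly_Mapping.single w c * f) =
    Poly_Mapping.single w c * homogeneous_part d (n - word_degree d w) f"
  by (induction f rule: free_algebra_induct)
    (auto simp: distrib_left homogeneous_part_add mult_single homogeneous_part_single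
      word_degree_plus)

lemma homogeneous_part_mult_single:
  "homogeneous_part d n (f * Poly_Mapping.single w c) =
    homogeneous_part d (n - word_degree d w) f * Poly_Mapping.single w c"
  by (induction f rule: free_algebra_induct)
    (auto simp: distrib_right homogeneous_part_add mult_single homogeneous_part_single
      word_degree_plus)

text \<open>The function \<open>h\<close> enumerates degrees; for the Veronese subalgebra they are the multiples of
  \<open>k\<close>.\<close>

lemma sum_homogeneous_parts:
  assumes "finite N" "inj_on h N" "\<And>w. w \<in> Poly_Mapping.keys f \<Longrightarrow> word_degree d w \<in> h ` N"
  shows "(\<Sum>n\<in>N. homogeneous_part d (h n) f) = f"
proof (rule poly_mapping_eqI)
  fix w
  show "Poly_Mapping.lookup (\<Sum>n\<in>N. homogeneous_part d (h n) f) w = Poly_Mapping.lookup f w"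
  proof (cases "w \<in> Poly_Mapping.keys f")
    case True
    then obtain m where m: "m \<in> N" "word_degree d w = h m" using assms(3) by blast
    have "Poly_Mapping.lookup (\<Sum>n\<in>N. homogeneous_part d (h n) f) w =
        (\<Sum>n\<in>N. if n = m then Poly_Mapping.lookup f w else 0)"
      unfolding lookup_sum
      using m assms(2) by (intro sum.cong) (auto simp: lookup_homogeneous_part inj_on_def)
    with assms(1) m(1) show ?thesis by simp
  next
    case False
    then show ?thesis
      by (auto simp: lookup_sum lookup_homogeneous_part in_keys_iff intro!: sum.neutral)
  qed
qed

text \<open>Multiplying by a word shifts the homogeneous parts, so the elements whose parts all lie in the
  relation ideal form an ideal themselves.\<close>

lemma homogeneous_part_relation_ideal:
  assumes S: "\<And>s. s \<in> S \<Longrightarrow> \<exists>m. s \<in> homogeneous d m" and f: "f \<in> relation_ideal S"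
  shows "homogeneous_part d n f \<in> relation_ideal S"
proof -
  let ?J = "{f. \<forall>n. homogeneous_part d n f \<in> relation_ideal S}"
  have "relation_ideal S \<subseteq> ?J"
  proof (rule relation_ideal_subset)
    show "S \<subseteq> ?J"
    proof
      fix s assume s: "s \<in> S"
      then obtain m where "s \<in> homogeneous d m" using S by blast
      with s show "s \<in> ?J"
        by (simp add: homogeneous_part_homogeneous relation_ideal_0 relation_ideal_generator)
    qed
    show "g * f \<in> ?J" if "f \<in> ?J" for f g
      using that
      by (induction g rule: free_algebra_induct)
        (auto simp: distrib_right homogeneous_part_add homogeneous_part_single_mult
          relation_ideal_0 intro!: relation_ideal_add relation_ideal_mult_left)
    show "f * g \<in> ?J" if "f \<in> ?J" for f g
      using that
      by (induction g rule: free_algebra_induct)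
        (auto simp: distrib_left homogeneous_part_add homogeneous_part_mult_single
          relation_ideal_0 intro!: relation_ideal_add relation_ideal_mult_right)
  qed (auto simp: homogeneous_part_add relation_ideal_0 relation_ideal_add)
  with f show ?thesis by blast
qed

text \<open>A lift of the \<open>k\<close>-th Veronese subalgebra to the free algebra.\<close>

definition veronese_span :: "('g \<Rightarrow> int) \<Rightarrow> nat \<Rightarrow> ('g, 'k::field) free_algebra set"
  where "veronese_span d k = {f. \<forall>w\<in>Poly_Mapping.keys f. int k dvd word_degree d w}"

lemma homogeneous_subset_veronese_span: "homogeneous d (n * int k) \<subseteq> veronese_span d k"
  by (auto simp: homogeneous_def veronese_span_def)

lemma veronese_span_zero: "0 \<in> veronese_span d k"
  by (simp add: veronese_span_def)

lemma veronese_span_add: "f \<in> veronese_span d k \<Longrightarrow> g \<in> veronese_span d k \<Longrightarrow> f + g \<in> veronese_span d k"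
  using keys_add[of f g] by (auto simp: veronese_span_def)

lemma veronese_span_sum:
  "(\<And>i. i \<in> I \<Longrightarrow> F i \<in> veronese_span d k) \<Longrightarrow> (\<Sum>i\<in>I. F i) \<in> veronese_span d k"
  by (induction I rule: infinite_finite_induct) (auto simp: veronese_span_zero veronese_span_add)

lemma sum_homogeneous_parts_veronese:
  assumes "k > 0" and f: "f \<in> veronese_span d k"
  obtains N where "finite N" "(\<Sum>n\<in>N. homogeneous_part d (n * int k) f) = f"
    "\<And>n. n \<notin> N \<Longrightarrow> homogeneous_part d (n * int k) f = 0"
proof
  let ?N = "(\<lambda>w. word_degree d w div int k) ` Poly_Mapping.keys f"
  have deg: "word_degree d w div int k * int k = word_degree d w" if "w \<in> Poly_Mapping.keys f" for w
    using f that by (simp add: veronese_span_def)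
  show "(\<Sum>n\<in>?N. homogeneous_part d (n * int k) f) = f"
    using \<open>k > 0\<close>
    by (intro sum_homogeneous_parts) (auto simp: inj_on_def image_iff deg intro!: bexI)
  show "homogeneous_part d (n * int k) f = 0" if "n \<notin> ?N" for n
    using that \<open>k > 0\<close>
    by (intro poly_mapping_eqI) (force simp: lookup_homogeneous_part in_keys_iff image_iff)
qed simp

lemma unital_algebra_veronese_span:
  "unital_algebra ring_of_type_algebra (residue_algebra S (veronese_span d k))"
proof (rule unital_algebra_residue_algebra)
  have "const c \<in> veronese_span d k" for c
    using homogeneous_const[of c d] homogeneous_subset_veronese_span[of d 0 k] by auto
  from this this[of 1] show "\<And>c. const c \<in> veronese_span d k" "1 \<in> veronese_span d k"
    by (simp_all add: const_simps)
  show "f * g \<in> veronese_span d k" if "f \<in> veronese_span d k" "g \<in> veronese_span d k" for f g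
    using that keys_mult[of f g] by (fastforce simp: veronese_span_def word_degree_plus)
qed (auto simp: veronese_span_zero veronese_span_add)

lemma veronese_algebra_presented:
  assumes "k > 0"
  shows "veronese_algebra k (presented_algebra S) (presented_component d S) =
    residue_algebra S (veronese_span d k)"
proof -
  interpret unital_algebra ring_of_type_algebra "presented_algebra S"
    by (rule unital_algebra_presented_algebra)
  have finsum: "finsum (presented_algebra S) (\<lambda>n. residue S (F n)) N = residue S (\<Sum>n\<in>N. F n)"
    if "finite N" for N :: "int set" and F
    using that by (intro finsum_residue M.abelian_monoid_axioms)
      (simp_all add: presented_algebra_simps)
  have "{finsum (presented_algebra S) f N | f N.
      finite N \<and> (\<forall>n\<in>N. f n \<in> veronese_component k (presented_component d S) n)} =
    residue S ` veronese_span d k" (is "?L = ?R")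
  proof
    show "?L \<subseteq> ?R"
    proof clarify
      fix f and N :: "int set"
      assume N: "finite N" "\<forall>n\<in>N. f n \<in> veronese_component k (presented_component d S) n"
      then have "\<forall>n\<in>N. \<exists>F. F \<in> homogeneous d (n * int k) \<and> f n = residue S F"
        by (auto simp: veronese_component_def presented_component_eq)
      then obtain F where F: "\<And>n. n \<in> N \<Longrightarrow> F n \<in> homogeneous d (n * int k) \<and> f n = residue S (F n)"
        by metis
      have "finsum (presented_algebra S) f N = finsum (presented_algebra S) (\<lambda>n. residue S (F n)) N"
        using F by (intro M.finsum_cong') (auto simp: presented_algebra_simps)
      also have "\<dots> = residue S (\<Sum>n\<in>N. F n)" using N(1) by (rule finsum)
      finally show "finsum (presented_algebra S) f N \<in> residue S ` veronese_span d k"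
        using F homogeneous_subset_veronese_span by (blast intro: veronese_span_sum)
    qed
    show "?R \<subseteq> ?L"
    proof clarify
      fix f :: "('a, 'b) free_algebra" assume "f \<in> veronese_span d k"
      from \<open>k > 0\<close> this obtain N where N: "finite N" "(\<Sum>n\<in>N. homogeneous_part d (n * int k) f) = f"
        by (rule sum_homogeneous_parts_veronese)
      with finsum[OF N(1), of "\<lambda>n. homogeneous_part d (n * int k) f"]
      show "\<exists>f' N. residue S f = finsum (presented_algebra S) f' N \<and> finite N \<and>
          (\<forall>n\<in>N. f' n \<in> veronese_component k (presented_component d S) n)"
        by (intro exI[of _ "\<lambda>n. residue S (homogeneous_part d (n * int k) f)"] exI[of _ N])
          (auto simp: veronese_component_def presented_component_eq homogeneous_part_in)
    qed
  qed
  then show ?thesis by (simp add: veronese_algebra_def)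
qed

text \<open>The homogeneous parts of an element of the free algebra give the decomposition of its residue.
  It is unique because the parts of a residue do not depend on the representative, the relation
  ideal being homogeneous.\<close>

lemma graded_algebra_veronese:
  assumes "k > 0" and S: "\<And>s. s \<in> S \<Longrightarrow> \<exists>m. s \<in> homogeneous d m"
  shows "graded_algebra ring_of_type_algebra
    (veronese_algebra k (presented_algebra S) (presented_component d S))
    (veronese_component k (presented_component d S))"
proof -
  let ?V = "residue_algebra S (veronese_span d k)"
  let ?G = "veronese_component k (presented_component d S)"
  interpret V: unital_algebra ring_of_type_algebra ?V
    by (rule unital_algebra_veronese_span)
  note simps = presented_algebra_simps ring_of_type_algebra_simps
  have G: "?G n = residue S ` homogeneous d (n * int k)" for n
    by (simp add: veronese_component_def presented_component_eq)
  have submodule: "submodule (?G n) ring_of_type_algebra ?V" for n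
  proof (rule V.submoduleI)
    show "?G n \<subseteq> carrier ?V"
      using homogeneous_subset_veronese_span[of d n k] by (auto simp: G)
    show "\<ominus>\<^bsub>?V\<^esub> a \<in> ?G n" if a: "a \<in> ?G n" for a
    proof -
      obtain f where f: "f \<in> homogeneous d (n * int k)" "a = residue S f" using a by (auto simp: G)
      with homogeneous_subset_veronese_span[of d n k] homogeneous_uminus[OF f(1)]
      have "\<ominus>\<^bsub>?V\<^esub> a = residue S (- f)"
        by (intro V.minus_equality) (auto simp: simps)
      with homogeneous_uminus[OF f(1)] show ?thesis by (auto simp: G)
    qed
  qed (auto simp: G simps homogeneous_zero intro: homogeneous_add homogeneous_scale)
  have part_cong: "residue S (homogeneous_part d n f) = residue S (homogeneous_part d n g)"
    if "residue S f = residue S g" for f g n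
  proof -
    have "homogeneous_part d n (f - g) + homogeneous_part d n g = homogeneous_part d n f"
      by (simp flip: homogeneous_part_add)
    moreover have "homogeneous_part d n (f - g) \<in> relation_ideal S"
      by (rule homogeneous_part_relation_ideal) (use S that in \<open>auto simp: residue_eq_iff\<close>)
    ultimately show ?thesis
      by (metis residue_eq_iff add_diff_cancel_right')
  qed
  have finsum: "finsum ?V (\<lambda>n. residue S (F n)) N = residue S (\<Sum>n\<in>N. F n)"
    if "finite N" "\<And>n. n \<in> N \<Longrightarrow> F n \<in> homogeneous d (n * int k)" for N :: "int set" and F
    using that homogeneous_subset_veronese_span[of d _ k]
    by (intro finsum_residue V.M.abelian_monoid_axioms) (auto simp: simps)
  have decomposition: "\<exists>!f. (\<forall>n. f n \<in> ?G n) \<and> finite {n. f n \<noteq> \<zero>\<^bsub>?V\<^esub>} \<and>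
      a = finsum ?V f {n. f n \<noteq> \<zero>\<^bsub>?V\<^esub>}" if a: "a \<in> carrier ?V" for a
  proof -
    obtain f where f: "f \<in> veronese_span d k" "a = residue S f" using a by auto
    let ?h = "\<lambda>n. residue S (homogeneous_part d (n * int k) f)"
    let ?N = "{n. ?h n \<noteq> \<zero>\<^bsub>?V\<^esub>}"
    obtain N where N: "finite N" "(\<Sum>n\<in>N. homogeneous_part d (n * int k) f) = f"
      "\<And>n. n \<notin> N \<Longrightarrow> homogeneous_part d (n * int k) f = 0"
      using \<open>k > 0\<close> f(1) by (rule sum_homogeneous_parts_veronese) blast
    have sub: "?N \<subseteq> N" using N(3) by (auto simp: simps)
    have "residue S (\<Sum>n\<in>N. homogeneous_part d (n * int k) f) =
        residue S (\<Sum>n\<in>N. if n \<in> ?N then homogeneous_part d (n * int k) f else 0)"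
      by (rule residue_sum_cong) (auto simp: simps)
    also have "(\<Sum>n\<in>N. if n \<in> ?N then homogeneous_part d (n * int k) f else 0) =
        (\<Sum>n\<in>?N. homogeneous_part d (n * int k) f)"
      using sub N(1) by (simp add: sum.If_cases Int_absorb1 flip: sum.inter_restrict)
    also have "residue S \<dots> = finsum ?V ?h ?N"
      using finite_subset[OF sub N(1)] by (intro finsum[symmetric] homogeneous_part_in)
    finally have a_eq: "a = finsum ?V ?h ?N" unfolding N(2) f(2) .
    show ?thesis
    proof (rule ex1I[of _ ?h], intro conjI)
      show "\<forall>n. ?h n \<in> ?G n" by (auto simp: G homogeneous_part_in)
      show "finite ?N" using finite_subset[OF sub N(1)] .
      show "a = finsum ?V ?h ?N" by (rule a_eq)
    next
      fix h assume h: "(\<forall>n. h n \<in> ?G n) \<and> finite {n. h n \<noteq> \<zero>\<^bsub>?V\<^esub>} \<and>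
        a = finsum ?V h {n. h n \<noteq> \<zero>\<^bsub>?V\<^esub>}"
      then have "\<forall>n. \<exists>F. F \<in> homogeneous d (n * int k) \<and> h n = residue S F" by (auto simp: G)
      then obtain F where F: "\<And>n. F n \<in> homogeneous d (n * int k)" "h = (\<lambda>n. residue S (F n))"
        by metis
      let ?M = "{n. h n \<noteq> \<zero>\<^bsub>?V\<^esub>}"
      have "finsum ?V h ?M = residue S (\<Sum>n\<in>?M. F n)"
        unfolding F(2) by (rule finsum) (use h F in auto)
      with h f(2) have eq: "residue S f = residue S (\<Sum>n\<in>?M. F n)" by simp
      show "h = ?h"
      proof
        fix m
        have "?h m = residue S (homogeneous_part d (m * int k) (\<Sum>n\<in>?M. F n))"
          using eq by (rule part_cong)
        also have "homogeneous_part d (m * int k) (\<Sum>n\<in>?M. F n) =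
            (\<Sum>n\<in>?M. if n = m then F m else 0)"
          using \<open>k > 0\<close> unfolding homogeneous_part_sum
          by (intro sum.cong) (auto simp: homogeneous_part_homogeneous[OF F(1)])
        also have "\<dots> = (if m \<in> ?M then F m else 0)" using h by simp
        also have "residue S \<dots> = h m" by (auto simp: F(2) simps)
        finally show "h m = ?h m" by simp
      qed
    qed
  qed
  show ?thesis
    unfolding veronese_algebra_presented[OF \<open>k > 0\<close>]
  proof (intro graded_algebra.intro graded_algebra_axioms.intro V.unital_algebra_axioms
      submodule decomposition)
    show "a \<otimes>\<^bsub>?V\<^esub> b \<in> ?G (m + n)" if "a \<in> ?G m" "b \<in> ?G n" for a b m n
      using that by (auto simp: G simps distrib_right intro!: homogeneous_mult)
  qed
qed


section \<open>Projective modules from dual bases\<close>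

lemma free_left_module_simps:
  "carrier (free_left_module R I) =
    {f. (\<forall>i. f i \<in> carrier R) \<and> (\<forall>i. i \<notin> I \<longrightarrow> f i = \<zero>\<^bsub>R\<^esub>) \<and> finite {i. f i \<noteq> \<zero>\<^bsub>R\<^esub>}}"
  "f \<oplus>\<^bsub>free_left_module R I\<^esub> g = (\<lambda>i. f i \<oplus>\<^bsub>R\<^esub> g i)"
  "\<zero>\<^bsub>free_left_module R I\<^esub> = (\<lambda>i. \<zero>\<^bsub>R\<^esub>)"
  "a \<odot>\<^bsub>free_left_module R I\<^esub> f = (\<lambda>i. a \<otimes>\<^bsub>R\<^esub> f i)"
  by (simp_all add: free_left_module_def)

lemma (in ring) abelian_group_free_left_module: "abelian_group (free_left_module R I)"
proof (rule abelian_groupI)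
  fix f g assume f: "f \<in> carrier (free_left_module R I)" and g: "g \<in> carrier (free_left_module R I)"
  have "{i. f i \<oplus> g i \<noteq> \<zero>} \<subseteq> {i. f i \<noteq> \<zero>} \<union> {i. g i \<noteq> \<zero>}" by auto
  then have "finite {i. f i \<oplus> g i \<noteq> \<zero>}"
    using f g by (auto simp: free_left_module_simps intro: finite_subset)
  with f g show "f \<oplus>\<^bsub>free_left_module R I\<^esub> g \<in> carrier (free_left_module R I)"
    by (auto simp: free_left_module_simps)
next
  fix f assume f: "f \<in> carrier (free_left_module R I)"
  then have "{i. \<ominus> f i \<noteq> \<zero>} \<subseteq> {i. f i \<noteq> \<zero>}" by (auto simp: free_left_module_simps)
  with f have "finite {i. \<ominus> f i \<noteq> \<zero>}" by (auto simp: free_left_module_simps intro: finite_subset)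
  with f show "\<exists>g\<in>carrier (free_left_module R I).
      g \<oplus>\<^bsub>free_left_module R I\<^esub> f = \<zero>\<^bsub>free_left_module R I\<^esub>"
    by (intro bexI[of _ "\<lambda>i. \<ominus> f i"]) (auto simp: free_left_module_simps l_neg)
qed (auto simp: free_left_module_simps a_ac)

text \<open>The dual basis lemma: if the coordinates with respect to a finite generating set can be chosen
  as linear forms, then they embed the module into a free one, and taking linear combinations of
  the generators splits the embedding.\<close>

locale finite_dual_basis = left_module R M
  for R :: "('r, 's) ring_scheme" and M :: "('r, 'm, 't) module_scheme" +
  fixes I :: "'m set" and \<phi> :: "'m \<Rightarrow> 'm \<Rightarrow> 'r"
  assumes finite_I: "finite I" and I_subset: "I \<subseteq> carrier M"
    and form_closed: "b \<in> I \<Longrightarrow> x \<in> carrier M \<Longrightarrow> \<phi> b x \<in> carrier R"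
    and form_add: "b \<in> I \<Longrightarrow> x \<in> carrier M \<Longrightarrow> y \<in> carrier M \<Longrightarrow>
      \<phi> b (x \<oplus>\<^bsub>M\<^esub> y) = \<phi> b x \<oplus>\<^bsub>R\<^esub> \<phi> b y"
    and form_smult: "b \<in> I \<Longrightarrow> a \<in> carrier R \<Longrightarrow> x \<in> carrier M \<Longrightarrow>
      \<phi> b (a \<odot>\<^bsub>M\<^esub> x) = a \<otimes>\<^bsub>R\<^esub> \<phi> b x"
    and expansion: "x \<in> carrier M \<Longrightarrow> x = (\<Oplus>\<^bsub>M\<^esub>b\<in>I. \<phi> b x \<odot>\<^bsub>M\<^esub> b)"
begin

lemma finitely_generated: "finitely_generated_left_module R M"
  unfolding finitely_generated_left_module_def
proof (intro conjI exI[of _ I] ballI left_module_axioms)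
  fix x assume x: "x \<in> carrier M"
  show "\<exists>c\<in>I \<rightarrow> carrier R. x = (\<Oplus>\<^bsub>M\<^esub>b\<in>I. c b \<odot>\<^bsub>M\<^esub> b)"
    using form_closed x by (intro bexI[of _ "\<lambda>b. \<phi> b x"] expansion) auto
qed (use finite_I I_subset in auto)

abbreviation F :: "('r, 'm \<Rightarrow> 'r) module"
  where "F \<equiv> free_left_module R I"

definition embed :: "'m \<Rightarrow> 'm \<Rightarrow> 'r"
  where "embed x = (\<lambda>b. if b \<in> I then \<phi> b x else \<zero>\<^bsub>R\<^esub>)"

definition combine :: "('m \<Rightarrow> 'r) \<Rightarrow> 'm"
  where "combine f = (\<Oplus>\<^bsub>M\<^esub>b\<in>I. f b \<odot>\<^bsub>M\<^esub> b)"

lemma embed_closed: "x \<in> carrier M \<Longrightarrow> embed x \<in> carrier F"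
proof -
  have "{b. embed x b \<noteq> \<zero>\<^bsub>R\<^esub>} \<subseteq> I" by (auto simp: embed_def)
  then show "x \<in> carrier M \<Longrightarrow> embed x \<in> carrier F"
    using finite_I form_closed by (auto simp: embed_def free_left_module_simps intro: finite_subset)
qed

lemma combine_closed: "f \<in> carrier F \<Longrightarrow> combine f \<in> carrier M"
  unfolding combine_def using I_subset
  by (intro M.finsum_closed) (auto simp: free_left_module_simps left_smult_closed)

lemma embed_add: "x \<in> carrier M \<Longrightarrow> y \<in> carrier M \<Longrightarrow> embed (x \<oplus>\<^bsub>M\<^esub> y) = embed x \<oplus>\<^bsub>F\<^esub> embed y"
  by (auto simp: embed_def free_left_module_simps form_add)

lemma embed_smult: "a \<in> carrier R \<Longrightarrow> x \<in> carrier M \<Longrightarrow> embed (a \<odot>\<^bsub>M\<^esub> x) = a \<odot>\<^bsub>F\<^esub> embed x"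
  by (auto simp: embed_def free_left_module_simps form_smult)

lemma combine_add:
  assumes "f \<in> carrier F" "g \<in> carrier F"
  shows "combine (f \<oplus>\<^bsub>F\<^esub> g) = combine f \<oplus>\<^bsub>M\<^esub> combine g"
proof -
  have "combine (f \<oplus>\<^bsub>F\<^esub> g) = (\<Oplus>\<^bsub>M\<^esub>b\<in>I. f b \<odot>\<^bsub>M\<^esub> b \<oplus>\<^bsub>M\<^esub> g b \<odot>\<^bsub>M\<^esub> b)"
    unfolding combine_def using assms I_subset
    by (intro M.finsum_cong')
      (auto simp: free_left_module_simps left_smult_l_distr left_smult_closed subset_iff)
  also have "\<dots> = combine f \<oplus>\<^bsub>M\<^esub> combine g"
    unfolding combine_def using assms I_subset
    by (intro M.finsum_addf) (auto simp: free_left_module_simps left_smult_closed subset_iff)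
  finally show ?thesis .
qed

lemma smult_zero:
  assumes "a \<in> carrier R" shows "a \<odot>\<^bsub>M\<^esub> \<zero>\<^bsub>M\<^esub> = \<zero>\<^bsub>M\<^esub>"
  using left_smult_r_distr[OF assms, of "\<zero>\<^bsub>M\<^esub>" "\<zero>\<^bsub>M\<^esub>"]
    left_smult_closed[OF assms, of "\<zero>\<^bsub>M\<^esub>"]
  by (metis M.add.l_cancel_one' M.r_zero M.zero_closed)

lemma combine_smult:
  assumes a: "a \<in> carrier R" and f: "f \<in> carrier F"
  shows "combine (a \<odot>\<^bsub>F\<^esub> f) = a \<odot>\<^bsub>M\<^esub> combine f"
proof -
  have "(\<Oplus>\<^bsub>M\<^esub>b\<in>J. (a \<otimes>\<^bsub>R\<^esub> f b) \<odot>\<^bsub>M\<^esub> b) = a \<odot>\<^bsub>M\<^esub> (\<Oplus>\<^bsub>M\<^esub>b\<in>J. f b \<odot>\<^bsub>M\<^esub> b)"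
    if "finite J" "J \<subseteq> I" for J
    using that
  proof (induction J rule: finite_induct)
    case (insert b J)
    with I_subset f have b: "b \<in> carrier M" "f b \<in> carrier R" "(\<lambda>b. f b \<odot>\<^bsub>M\<^esub> b) \<in> J \<rightarrow> carrier M"
      by (auto simp: free_left_module_simps left_smult_closed subset_iff)
    moreover have "(\<lambda>b. (a \<otimes>\<^bsub>R\<^esub> f b) \<odot>\<^bsub>M\<^esub> b) \<in> J \<rightarrow> carrier M"
      using insert.prems I_subset f a
      by (auto simp: free_left_module_simps intro!: left_smult_closed)
    ultimately show ?case
      using insert a by (simp add: left_smult_r_distr left_smult_assoc left_smult_closed)
  qed (simp add: smult_zero a)
  from this[OF finite_I subset_refl] show ?thesis
    by (simp add: combine_def free_left_module_simps)
qed

lemma combine_embed: "x \<in> carrier M \<Longrightarrow> combine (embed x) = x"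
  unfolding combine_def using expansion[of x] form_closed I_subset
  by (subst M.finsum_cong'[where g = "\<lambda>b. \<phi> b x \<odot>\<^bsub>M\<^esub> b"])
    (auto simp: embed_def left_smult_closed)

text \<open>The complement of the embedded module is the kernel of the retraction.\<close>

lemma projective: "projective_left_module R M"
proof -
  interpret F: abelian_group F by (rule R.abelian_group_free_left_module)
  let ?P = "embed ` carrier M" and ?Q = "{f \<in> carrier F. combine f = \<zero>\<^bsub>M\<^esub>}"
  interpret embed: group_hom "add_monoid M" "add_monoid F" embed
    by (intro group_hom.intro group_hom_axioms.intro homI M.a_group F.a_group)
      (simp_all add: embed_closed embed_add)
  interpret combine: group_hom "add_monoid F" "add_monoid M" combine
    by (intro group_hom.intro group_hom_axioms.intro homI M.a_group F.a_group)
      (simp_all add: combine_closed combine_add)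
  have P: "submodule ?P R F"
    using embed.img_is_subgroup
    by (intro submodule.intro submodule_axioms.intro)
      (auto simp: left_smult_closed simp flip: embed_smult)
  have F_smult: "a \<odot>\<^bsub>F\<^esub> f \<in> carrier F" if "a \<in> carrier R" "f \<in> carrier F" for a f
  proof -
    have "{i. a \<otimes>\<^bsub>R\<^esub> f i \<noteq> \<zero>\<^bsub>R\<^esub>} \<subseteq> {i. f i \<noteq> \<zero>\<^bsub>R\<^esub>}" using that(1) by auto
    with that show ?thesis by (auto simp: free_left_module_simps intro: finite_subset)
  qed
  have Q: "submodule ?Q R F"
    using combine.subgroup_kernel
    by (intro submodule.intro submodule_axioms.intro)
      (auto simp: kernel_def combine_smult smult_zero F_smult)
  have zero: "embed \<zero>\<^bsub>M\<^esub> = \<zero>\<^bsub>F\<^esub>" "combine \<zero>\<^bsub>F\<^esub> = \<zero>\<^bsub>M\<^esub>"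
    using embed.hom_one combine.hom_one by simp_all
  have inter: "?P \<inter> ?Q = {\<zero>\<^bsub>F\<^esub>}"
    using zero by (auto simp: combine_embed intro!: image_eqI[of _ _ "\<zero>\<^bsub>M\<^esub>"])
  have "f \<in> ?P <+>\<^bsub>F\<^esub> ?Q" if f: "f \<in> carrier F" for f
  proof -
    let ?g = "embed (combine f)"
    have g: "?g \<in> carrier F" using f by (simp add: embed_closed combine_closed)
    have sum: "?g \<oplus>\<^bsub>F\<^esub> (\<ominus>\<^bsub>F\<^esub> ?g \<oplus>\<^bsub>F\<^esub> f) = f"
      using f g by (simp flip: F.a_assoc add: F.r_neg)
    have "combine f \<oplus>\<^bsub>M\<^esub> combine (\<ominus>\<^bsub>F\<^esub> ?g \<oplus>\<^bsub>F\<^esub> f) = combine f"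
      using combine_add[of ?g "\<ominus>\<^bsub>F\<^esub> ?g \<oplus>\<^bsub>F\<^esub> f"] f g
      by (simp add: sum combine_embed combine_closed)
    then have "combine (\<ominus>\<^bsub>F\<^esub> ?g \<oplus>\<^bsub>F\<^esub> f) = \<zero>\<^bsub>M\<^esub>"
      using f g by (metis F.a_inv_closed F.a_closed M.add.l_cancel_one' combine_closed)
    with f g have "\<ominus>\<^bsub>F\<^esub> ?g \<oplus>\<^bsub>F\<^esub> f \<in> ?Q" "?g \<in> ?P"
      by (auto simp: combine_closed)
    then have "?g \<oplus>\<^bsub>F\<^esub> (\<ominus>\<^bsub>F\<^esub> ?g \<oplus>\<^bsub>F\<^esub> f) \<in> ?P <+>\<^bsub>F\<^esub> ?Q"
      unfolding set_add_def set_mult_def by fastforce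
    then show ?thesis by (simp only: sum)
  qed
  moreover have "?P <+>\<^bsub>F\<^esub> ?Q \<subseteq> carrier F"
    by (rule F.set_add_closed) (auto simp: embed_closed)
  ultimately have sum: "?P <+>\<^bsub>F\<^esub> ?Q = carrier F" by blast
  have "inj_on embed (carrier M)"
    by (rule inj_on_inverseI[of _ combine]) (rule combine_embed)
  then have "left_module_isomorphic R M (F\<lparr>carrier := ?P\<rparr>)"
    unfolding left_module_isomorphic_def
    by (intro exI[of _ embed]) (auto simp: embed_add embed_smult bij_betw_def)
  with P Q inter sum show ?thesis
    unfolding projective_left_module_def using left_module_axioms by blast
qed

end


section \<open>Partitions of unity in graded algebras\<close>

text \<open>Expanding the unit in \<open>x = 1 \<cdot> x\<close> or \<open>x = x \<cdot> 1\<close> moves \<open>x\<close> between degrees. This gives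
  the strong grading, dual bases of the components, and all homomorphisms between components. A
  strongly graded algebra has such expansions with finitely many products; two of them are enough
  for \<open>\<A>(p; q\<^sub>\<plusminus>)\<close>.\<close>

locale graded_partition_of_unity = graded_algebra R A G
  for R :: "('k, 'r) ring_scheme" and A :: "('k, 'a) module" (structure) and G +
  assumes one_mem: "\<one> \<in> G 0"
    and partition: "\<exists>a\<in>G n. \<exists>b\<in>G (- n). \<exists>a'\<in>G n. \<exists>b'\<in>G (- n). \<one> = a \<otimes> b \<oplus> a' \<otimes> b'"
begin

lemma component_subgroup: "subgroup (G n) (add_monoid A)"
  using component_submodule submodule_def by blast

lemma component_closed: "x \<in> G n \<Longrightarrow> x \<in> carrier A"
  using subgroup.subset[OF component_subgroup] by auto

lemma component_zero: "\<zero> \<in> G n"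
  using subgroup.one_closed[OF component_subgroup] by simp

lemma component_add: "x \<in> G n \<Longrightarrow> y \<in> G n \<Longrightarrow> x \<oplus> y \<in> G n"
  using subgroup.m_closed[OF component_subgroup] by simp

lemma component_minus: "x \<in> G n \<Longrightarrow> \<ominus> x \<in> G n"
  using subgroup.m_inv_closed[OF component_subgroup] by (simp add: a_inv_def)

lemma component_mult': "x \<in> G m \<Longrightarrow> y \<in> G n \<Longrightarrow> m + n = l \<Longrightarrow> x \<otimes> y \<in> G l"
  using component_mult by blast

lemma strongly_graded: "strongly_graded_algebra R A G"
proof (unfold_locales, intro equalityI subsetI)
  fix m n x
  show "x \<in> G (m + n)" if "x \<in> ideal_prod A (G m) (G n)"
    using that by induction (auto intro: component_mult component_add)
  assume x: "x \<in> G (m + n)"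
  obtain a b a' b' where *: "a \<in> G m" "b \<in> G (- m)" "a' \<in> G m" "b' \<in> G (- m)"
      "\<one> = a \<otimes> b \<oplus> a' \<otimes> b'"
    using partition by blast
  have "b \<otimes> x \<in> G n" "b' \<otimes> x \<in> G n" using * x by (auto intro: component_mult')
  moreover have "x = a \<otimes> (b \<otimes> x) \<oplus> a' \<otimes> (b' \<otimes> x)"
    using * x by (metis component_closed l_distr l_one m_assoc m_closed)
  ultimately show "x \<in> ideal_prod A (G m) (G n)"
    using * by (metis ideal_prod.prod ideal_prod.sum)
qed

lemma ring_degree_zero_part: "ring (degree_zero_part A G)"
proof -
  have "subring (G 0) A"
    using component_closed component_mult[of _ 0 _ 0]
    by (intro subringI) (auto simp: one_mem component_minus component_add)
  then show ?thesis
    unfolding degree_zero_part_def by (rule subring_is_ring)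
qed

lemma left_module_component: "left_module (degree_zero_part A G) (component_module A G n)"
proof (intro left_module.intro left_module_axioms.intro ring_degree_zero_part)
  show "abelian_group (component_module A G n)"
  proof (rule abelian_groupI)
    fix x assume "x \<in> carrier (component_module A G n)"
    then show "\<exists>y\<in>carrier (component_module A G n).
        y \<oplus>\<^bsub>component_module A G n\<^esub> x = \<zero>\<^bsub>component_module A G n\<^esub>"
      by (intro bexI[of _ "\<ominus> x"])
        (auto simp: component_module_def component_minus component_closed l_neg)
  qed (auto simp: component_module_def component_closed component_zero component_add a_ac)
qed (use component_mult'[of _ 0 _ n n] in
    \<open>auto simp: component_module_def degree_zero_part_def component_closed l_distr r_distr m_assoc\<close>)

lemma abelian_group_component_module: "abelian_group (component_module A G n)"
  using left_module_component left_module_def by blast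

lemma finite_dual_basis_component:
  "\<exists>I \<phi>. finite_dual_basis (degree_zero_part A G) (component_module A G n) I \<phi>"
proof -
  interpret comp: abelian_group "component_module A G n" by (rule abelian_group_component_module)
  obtain a b a' b' where *: "a \<in> G (- n)" "b \<in> G n" "a' \<in> G (- n)" "b' \<in> G n"
      "\<one> = a \<otimes> b \<oplus> a' \<otimes> b'"
    using partition[of "- n"] by auto
  note carrier = *(1-4)[THEN component_closed]
  define I where "I = {b, b'}"
  (* The two generators may coincide; then their coefficients are added up. *)
  define c where "c i = (if b = b' then a \<oplus> a' else if i = b then a else a')" for i
  have c: "c i \<in> G (- n)" for i using * by (simp add: c_def component_add)
  have finsum: "(\<Oplus>\<^bsub>component_module A G n\<^esub>i\<in>I. x \<otimes> c i \<otimes> i) = x" if x: "x \<in> G n" for x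
  proof -
    have closed: "x \<otimes> c i \<otimes> i \<in> carrier (component_module A G n)" if "i \<in> I" for i
      using that * x component_mult'[OF component_mult'[OF x c refl]]
      by (auto simp: I_def component_module_def)
    have expand: "x = x \<otimes> a \<otimes> b \<oplus> x \<otimes> a' \<otimes> b'"
      using *(5) carrier component_closed[OF x] by (metis m_assoc m_closed r_distr r_one)
    show ?thesis
    proof (cases "b = b'")
      case True
      then have "(\<Oplus>\<^bsub>component_module A G n\<^esub>i\<in>I. x \<otimes> c i \<otimes> i) = x \<otimes> c b \<otimes> b"
        using closed[of b] by (simp add: I_def)
      also have "\<dots> = x"
        using expand True carrier component_closed[OF x] by (simp add: c_def r_distr l_distr)
      finally show ?thesis .
    next
      case False
      then have "(\<Oplus>\<^bsub>component_module A G n\<^esub>i\<in>I. x \<otimes> c i \<otimes> i) =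
          x \<otimes> c b \<otimes> b \<oplus>\<^bsub>component_module A G n\<^esub> x \<otimes> c b' \<otimes> b'"
        using closed[of b] closed[of b'] by (simp add: I_def)
      also have "\<dots> = x"
        using False expand by (simp add: c_def component_module_def)
      finally show ?thesis .
    qed
  qed
  have "finite_dual_basis (degree_zero_part A G) (component_module A G n) I (\<lambda>i x. x \<otimes> c i)"
  proof (intro finite_dual_basis.intro finite_dual_basis_axioms.intro left_module_component)
    show "finite I" "I \<subseteq> carrier (component_module A G n)"
      using * by (auto simp: I_def component_module_def)
    show "x = (\<Oplus>\<^bsub>component_module A G n\<^esub>i\<in>I. x \<otimes> c i \<odot>\<^bsub>component_module A G n\<^esub> i)"
      if "x \<in> carrier (component_module A G n)" for x
      using finsum[of x] that by (simp add: component_module_def)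
  qed (use c[THEN component_closed] component_mult'[OF _ c] in
      \<open>auto simp: component_module_def degree_zero_part_def component_closed l_distr m_assoc\<close>)
  then show ?thesis by blast
qed

lemma projective_component: "projective_left_module (degree_zero_part A G) (component_module A G n)"
  using finite_dual_basis_component finite_dual_basis.projective by blast

lemma finitely_generated_component:
  "finitely_generated_left_module (degree_zero_part A G) (component_module A G n)"
  using finite_dual_basis_component finite_dual_basis.finitely_generated by blast

text \<open>Apply the map to \<open>x = x \<cdot> 1\<close> and expand \<open>1\<close>: the left factors of the expansion move \<open>x\<close>
  into degree \<open>0\<close>, so they come out by linearity and leave \<open>x\<close> times a fixed element.\<close>

lemma component_hom_is_right_mult:
  assumes h: "\<And>x. x \<in> G m \<Longrightarrow> h x \<in> G n"
    and h_add: "\<And>x y. x \<in> G m \<Longrightarrow> y \<in> G m \<Longrightarrow> h (x \<oplus> y) = h x \<oplus> h y"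
    and h_mult: "\<And>a x. a \<in> G 0 \<Longrightarrow> x \<in> G m \<Longrightarrow> h (a \<otimes> x) = a \<otimes> h x"
  obtains u where "u \<in> G (n - m)" "\<And>x. x \<in> G m \<Longrightarrow> h x = x \<otimes> u"
proof -
  obtain a b a' b' where *: "a \<in> G (- m)" "b \<in> G m" "a' \<in> G (- m)" "b' \<in> G m"
      "\<one> = a \<otimes> b \<oplus> a' \<otimes> b'"
    using partition[of "- m"] by auto
  note carrier = *(1-4)[THEN component_closed] h[OF *(2), THEN component_closed]
    h[OF *(4), THEN component_closed]
  show thesis
  proof
    show "a \<otimes> h b \<oplus> a' \<otimes> h b' \<in> G (n - m)"
      using * h by (intro component_add) (auto intro!: component_mult'[of _ "- m" _ n])
    fix x assume x: "x \<in> G m"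
    have deg0: "x \<otimes> a \<in> G 0" "x \<otimes> a' \<in> G 0"
      using x * by (auto intro: component_mult')
    have "x = (x \<otimes> a) \<otimes> b \<oplus> (x \<otimes> a') \<otimes> b'"
      using *(5) carrier component_closed[OF x] by (metis m_assoc m_closed r_distr r_one)
    then have "h x = h ((x \<otimes> a) \<otimes> b \<oplus> (x \<otimes> a') \<otimes> b')" by simp
    also have "\<dots> = (x \<otimes> a) \<otimes> h b \<oplus> (x \<otimes> a') \<otimes> h b'"
      using deg0 * component_mult'[of _ 0 _ m m] by (simp add: h_add h_mult)
    also have "\<dots> = x \<otimes> (a \<otimes> h b \<oplus> a' \<otimes> h b')"
      using carrier component_closed[OF x] by (simp add: m_assoc r_distr)
    finally show "h x = x \<otimes> (a \<otimes> h b \<oplus> a' \<otimes> h b')" .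
  qed
qed

text \<open>A single component is faithful as a right module, because the unit is a combination of its
  elements.\<close>

lemma right_mult_eq_one:
  assumes u: "u \<in> carrier A" and id: "\<And>x. x \<in> G m \<Longrightarrow> x \<otimes> u = x"
  shows "u = \<one>"
proof -
  obtain a b a' b' where *: "a \<in> G (- m)" "b \<in> G m" "a' \<in> G (- m)" "b' \<in> G m"
      "\<one> = a \<otimes> b \<oplus> a' \<otimes> b'"
    using partition[of "- m"] by auto
  note carrier = *(1-4)[THEN component_closed]
  have "u = (a \<otimes> b \<oplus> a' \<otimes> b') \<otimes> u" using u by (simp flip: *(5))
  also have "\<dots> = a \<otimes> (b \<otimes> u) \<oplus> a' \<otimes> (b' \<otimes> u)" using carrier u by (simp add: m_assoc l_distr)
  also have "\<dots> = \<one>" using id *(2,4) by (simp add: *(5))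
  finally show ?thesis .
qed

text \<open>The isomorphism and its inverse are right multiplications, and the product of the two factors
  fixes a component.\<close>

lemma component_iso_imp_unit:
  assumes "left_module_isomorphic (degree_zero_part A G) (component_module A G m) (component_module A G n)"
  obtains u v where "u \<in> G (n - m)" "v \<in> G (m - n)" "u \<otimes> v = \<one>" "v \<otimes> u = \<one>"
proof -
  obtain h where bij: "bij_betw h (G m) (G n)"
    and h_add: "\<And>x y. x \<in> G m \<Longrightarrow> y \<in> G m \<Longrightarrow> h (x \<oplus> y) = h x \<oplus> h y"
    and h_mult: "\<And>a x. a \<in> G 0 \<Longrightarrow> x \<in> G m \<Longrightarrow> h (a \<otimes> x) = a \<otimes> h x"
    using assms by (auto simp: left_module_isomorphic_def component_module_def degree_zero_part_def)
  define g where "g = inv_into (G m) h"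
  have h: "h x \<in> G n" if "x \<in> G m" for x using bij that by (auto simp: bij_betw_def)
  have g: "g y \<in> G m" "h (g y) = y" if "y \<in> G n" for y
    using bij that by (auto simp: bij_betw_def g_def inv_into_into f_inv_into_f)
  have gh: "g (h x) = x" if "x \<in> G m" for x
    using bij that by (simp add: bij_betw_def g_def)
  have g_add: "g (x \<oplus> y) = g x \<oplus> g y" if "x \<in> G n" "y \<in> G n" for x y
    using gh[of "g x \<oplus> g y"] that by (simp add: h_add g component_add)
  have g_mult: "g (a \<otimes> x) = a \<otimes> g x" if "a \<in> G 0" "x \<in> G n" for a x
    using gh[of "a \<otimes> g x"] that by (simp add: h_mult g component_mult'[of _ 0 _ m m])
  obtain u where u: "u \<in> G (n - m)" "\<And>x. x \<in> G m \<Longrightarrow> h x = x \<otimes> u"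
    using component_hom_is_right_mult[OF h h_add h_mult] by blast
  obtain v where v: "v \<in> G (m - n)" "\<And>x. x \<in> G n \<Longrightarrow> g x = x \<otimes> v"
    using component_hom_is_right_mult[OF g(1) g_add g_mult] by blast
  note carrier = u(1)[THEN component_closed] v(1)[THEN component_closed]
  have "x \<otimes> (u \<otimes> v) = x" if "x \<in> G m" for x
    using gh[OF that] that carrier h by (simp add: u(2) v(2) component_closed m_assoc)
  then have "u \<otimes> v = \<one>" by (rule right_mult_eq_one[OF m_closed[OF carrier]])
  moreover have "x \<otimes> (v \<otimes> u) = x" if "x \<in> G n" for x
    using g[OF that] that carrier by (simp add: u(2) v(2) component_closed m_assoc)
  then have "v \<otimes> u = \<one>" by (rule right_mult_eq_one[OF m_closed[OF carrier(2,1)]])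
  ultimately show thesis using that u(1) v(1) by blast
qed

lemma unit_imp_component_iso:
  assumes u: "u \<in> G n" "v \<in> G (- n)" "u \<otimes> v = \<one>" "v \<otimes> u = \<one>"
  shows "left_module_isomorphic (degree_zero_part A G) (component_module A G 0) (component_module A G n)"
proof -
  note carrier = u(1,2)[THEN component_closed]
  have "bij_betw (\<lambda>x. x \<otimes> u) (G 0) (G n)"
    using u carrier
    by (intro bij_betw_byWitness[where f' = "\<lambda>x. x \<otimes> v"])
      (auto simp: component_closed m_assoc intro: component_mult')
  then show ?thesis
    unfolding left_module_isomorphic_def
    by (intro exI[of _ "\<lambda>x. x \<otimes> u"])
      (auto simp: component_module_def degree_zero_part_def component_closed carrier l_distr m_assoc)
qed

end


section \<open>Evaluation of polynomials in free algebras\<close>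

lemma poly_at_eq_sum:
  assumes "Polynomial.degree f \<le> N"
  shows "poly_at f a = (\<Sum>i\<le>N. const (Polynomial.coeff f i) * a ^ i)"
  unfolding poly_at_def using assms
  by (intro sum.mono_neutral_left) (auto simp: coeff_eq_0 const_simps)

lemma poly_at_add: "poly_at (f + g) a = poly_at f a + poly_at g a"
proof -
  let ?N = "max (Polynomial.degree f) (Polynomial.degree g)"
  have "Polynomial.degree (f + g) \<le> ?N" by (rule degree_add_le_max)
  then show ?thesis
    by (simp add: poly_at_eq_sum[of _ ?N] const_simps distrib_right sum.distrib)
qed

lemma poly_at_pCons: "poly_at (pCons c f) a = const c + a * poly_at f a"
proof -
  have "poly_at (pCons c f) a =
      (\<Sum>i\<le>Suc (Polynomial.degree f). const (Polynomial.coeff (pCons c f) i) * a ^ i)"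
    by (rule poly_at_eq_sum) (rule degree_pCons_le)
  also have "\<dots> = const c + a * poly_at f a"
    unfolding sum.atMost_Suc_shift
    by (simp add: poly_at_def sum_distrib_left mult_const_left_commute)
  finally show ?thesis .
qed

lemma poly_at_0 [simp]: "poly_at 0 a = 0"
  by (simp add: poly_at_def const_simps)

lemma poly_at_const: "poly_at [:c:] a = const c"
  by (simp add: poly_at_pCons)

lemma poly_at_1 [simp]: "poly_at 1 a = 1"
  using poly_at_const[of 1 a] by (simp add: const_simps pCons_one)

lemma poly_at_smult: "poly_at (Polynomial.smult c f) a = const c * poly_at f a"
  by (induction f) (simp_all add: poly_at_pCons const_simps distrib_left mult_const_left_commute)

lemma poly_at_mult: "poly_at (f * g) a = poly_at f a * poly_at g a"
  by (induction f)
    (simp_all add: poly_at_pCons poly_at_add poly_at_smult distrib_right const_simps mult.assoc)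

lemma poly_at_power: "poly_at (f ^ n) a = poly_at f a ^ n"
  by (induction n) (simp_all add: poly_at_mult)

lemma poly_at_X: "poly_at [:0, 1:] a = a"
  by (simp add: poly_at_pCons const_simps)

text \<open>Rescaling the variable is the only composition that occurs: it is what moving a generator past
  a polynomial in \<open>w\<close> amounts to.\<close>

lemma poly_at_scale_variable: "poly_at (pcompose f [:0, c:]) a = poly_at f (const c * a)"
  by (induction f)
    (simp_all add: pcompose_pCons poly_at_pCons poly_at_add poly_at_mult poly_at_const poly_at_X
      poly_at_smult const_simps mult_const_left_commute mult.assoc)

section \<open>Commutation up to a scalar\<close>

definition q_commute :: "('g, 'k::field) free_algebra set \<Rightarrow> 'k \<Rightarrow> ('g, 'k) free_algebra
    \<Rightarrow> ('g, 'k) free_algebra \<Rightarrow> bool"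
  where "q_commute S c a b \<longleftrightarrow> residue S (a * b) = residue S (const c * (b * a))"

lemma q_commuteD: "q_commute S c a b \<Longrightarrow> residue S (a * b) = residue S (const c * (b * a))"
  by (simp add: q_commute_def)

lemma q_commute_one_right: "q_commute S 1 a 1"
  by (simp add: q_commute_def const_simps)

lemma q_commute_one_left: "q_commute S 1 1 b"
  by (simp add: q_commute_def const_simps)

lemma q_commute_mult_right:
  assumes "q_commute S c a b" "q_commute S c' a b'"
  shows "q_commute S (c * c') a (b * b')"
proof -
  have "residue S (a * b * b') = residue S (const c * (b * a) * b')"
    by (rule residue_mult_cong[OF q_commuteD[OF assms(1)] refl])
  also have "const c * (b * a) * b' = const c * b * (a * b')" by (simp add: mult.assoc)
  also have "residue S \<dots> = residue S (const c * b * (const c' * (b' * a)))"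
    by (rule residue_mult_cong[OF refl q_commuteD[OF assms(2)]])
  finally show ?thesis
    by (simp add: q_commute_def const_simps mult.assoc mult_const_left_commute[of b])
qed

lemma q_commute_mult_left:
  assumes "q_commute S c a b" "q_commute S c' a' b"
  shows "q_commute S (c * c') (a * a') b"
proof -
  have "residue S (a * (a' * b)) = residue S (a * (const c' * (b * a')))"
    by (rule residue_mult_cong[OF refl q_commuteD[OF assms(2)]])
  also have "a * (const c' * (b * a')) = (a * b) * (const c' * a')"
    by (simp add: mult.assoc mult_const_left_commute)
  also have "residue S \<dots> = residue S ((const c * (b * a)) * (const c' * a'))"
    by (rule residue_mult_cong[OF q_commuteD[OF assms(1)] refl])
  finally show ?thesis
    by (simp add: q_commute_def const_simps mult.assoc mult_const_left_commute[of a] mult_const_left_commute[of b])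
qed

lemma q_commute_power_right: "q_commute S c a b \<Longrightarrow> q_commute S (c ^ n) a (b ^ n)"
  by (induction n) (auto simp: q_commute_one_right intro: q_commute_mult_right)

lemma q_commute_power_left: "q_commute S c a b \<Longrightarrow> q_commute S (c ^ n) (a ^ n) b"
  by (induction n) (auto simp: q_commute_one_left intro: q_commute_mult_left)

lemma q_commute_poly:
  assumes "q_commute S c a b"
  shows "residue S (a * poly_at f b) = residue S (poly_at (pcompose f [:0, c:]) b * a)"
proof (induction f)
  case (pCons x f)
  have "residue S (a * (b * poly_at f b)) = residue S (a * b * poly_at f b)"
    by (simp add: mult.assoc)
  also have "\<dots> = residue S (const c * (b * a) * poly_at f b)"
    by (rule residue_mult_cong[OF q_commuteD[OF assms] refl])
  also have "\<dots> = residue S (const c * b * (a * poly_at f b))" by (simp add: mult.assoc)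
  also have "\<dots> = residue S (const c * b * (poly_at (pcompose f [:0, c:]) b * a))"
    by (rule residue_mult_cong[OF refl pCons.IH])
  finally have "residue S (a * const x + a * (b * poly_at f b)) =
      residue S (const x * a + const c * b * (poly_at (pcompose f [:0, c:]) b * a))"
    by (intro residue_add_cong) (simp_all add: const_commute)
  then show ?case
    by (simp add: poly_at_pCons pcompose_pCons poly_at_add poly_at_mult poly_at_const poly_at_X
        poly_at_smult const_simps distrib_left distrib_right mult.assoc
        mult_const_left_commute[of b])
qed simp

lemma q_commute_1_poly:
  assumes "q_commute S 1 a b"
  shows "residue S (a * poly_at f b) = residue S (poly_at f b * a)"
  using q_commute_poly[OF assms] by simp


text \<open>The common step of the normal forms of both algebras: a generator moves past the coefficient
  polynomial of a monomial, whose variable it rescales.\<close>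

lemma mult_poly_at_mult:
  assumes c: "q_commute S c a t" and e: "\<exists>f. residue S (a * e) = residue S (poly_at f t * e')"
  shows "\<exists>g. residue S (a * (poly_at f t * e)) = residue S (poly_at g t * e')"
proof -
  obtain f' where f': "residue S (a * e) = residue S (poly_at f' t * e')" using e by blast
  have "residue S (a * (poly_at f t * e)) = residue S (a * poly_at f t * e)"
    by (simp only: mult.assoc)
  also have "\<dots> = residue S (poly_at (pcompose f [:0, c:]) t * a * e)"
    by (rule residue_mult_cong[OF q_commute_poly[OF c] refl])
  also have "\<dots> = residue S (poly_at (pcompose f [:0, c:]) t * (a * e))"
    by (simp only: mult.assoc)
  also have "\<dots> = residue S (poly_at (pcompose f [:0, c:]) t * (poly_at f' t * e'))"
    by (rule residue_mult_cong[OF refl f'])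
  also have "\<dots> = residue S (poly_at (pcompose f [:0, c:] * f') t * e')"
    by (simp only: poly_at_mult mult.assoc)
  finally show ?thesis by blast
qed


section \<open>Generalized Weyl algebra relations\<close>

text \<open>Both algebras contain elements with these relations. In \<open>\<B>(p; q, 0)\<close> they are the generators
  \<open>y\<close>, \<open>x\<close>, \<open>z\<close> with the polynomial \<open>p\<close>; in \<open>\<A>(p; q\<^sub>\<plusminus>)\<close> they are \<open>x\<^sub>+\<close>, \<open>x\<^sub>-\<close> and
  \<open>w = z\<^sub>+z\<^sub>-\<close> with the polynomial \<open>P\<close>.\<close>

locale weyl_relations =
  fixes S :: "('g, 'k::field) free_algebra set" and x y t :: "('g, 'k) free_algebra"
    and P :: "'k poly" and q :: 'k
  assumes q: "q \<noteq> 0"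
    and xy: "residue S (x * y) = residue S (poly_at P t)"
    and yx: "residue S (y * x) = residue S (poly_at P (const q * t))"
    and xt: "q_commute S (inverse q) x t"
    and yt: "q_commute S q y t"
begin

definition xpow :: "int \<Rightarrow> ('g, 'k) free_algebra"
  where "xpow n = (if n \<ge> 0 then x ^ nat n else y ^ nat (- n))"

lemma xpow_0: "xpow 0 = 1"
  by (simp add: xpow_def)

lemma x_xpow: "\<exists>f. residue S (x * xpow n) = residue S (poly_at f t * xpow (n + 1))"
proof (cases "n \<ge> 0")
  case True
  then have "x * xpow n = poly_at 1 t * xpow (n + 1)"
    by (simp add: xpow_def nat_add_distrib)
  then show ?thesis by (intro exI[of _ 1]) simp
next
  case False
  then have "nat (- n) = Suc (nat (- (n + 1)))" by simp
  with False have "x * xpow n = x * y * xpow (n + 1)"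
    by (auto simp: xpow_def mult.assoc)
  then show ?thesis using residue_mult_cong[OF xy refl, of "xpow (n + 1)"] by (intro exI[of _ P]) simp
qed

lemma y_xpow: "\<exists>f. residue S (y * xpow n) = residue S (poly_at f t * xpow (n - 1))"
proof (cases "n \<le> 0")
  case True
  then have "nat (- (n - 1)) = Suc (nat (- n))" by simp
  with True have "y * xpow n = poly_at 1 t * xpow (n - 1)"
    by (auto simp: xpow_def)
  then show ?thesis by (intro exI[of _ 1]) simp
next
  case False
  then have "nat n = Suc (nat (n - 1))" by simp
  with False have "y * xpow n = y * x * xpow (n - 1)"
    by (simp add: xpow_def mult.assoc)
  then have "residue S (y * xpow n) = residue S (poly_at (pcompose P [:0, q:]) t * xpow (n - 1))"
    using residue_mult_cong[OF yx refl, of "xpow (n - 1)"] by (simp add: poly_at_scale_variable)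
  then show ?thesis by blast
qed

text \<open>The innermost factors \<open>x \<cdot> y\<close> become \<open>P(t)\<close>, and moving polynomials outwards only rescales
  their variable, which leaves the value at \<open>0\<close> unchanged.\<close>

lemma x_power_y_power:
  "\<exists>Q. residue S (x ^ n * y ^ n) = residue S (poly_at Q t) \<and> poly Q 0 = poly P 0 ^ n"
proof (induction n)
  case 0
  show ?case by (intro exI[of _ 1]) simp
next
  case (Suc n)
  then obtain Q where Q: "residue S (x ^ n * y ^ n) = residue S (poly_at Q t)"
    "poly Q 0 = poly P 0 ^ n" by blast
  have "x ^ Suc n * y ^ Suc n = x * (x ^ n * y ^ n) * y"
    unfolding power_Suc[of x n] power_Suc2[of y n] by (simp add: mult.assoc)
  also have "residue S \<dots> = residue S (x * poly_at Q t * y)"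
    using Q(1) by (intro residue_mult_cong refl)
  also have "\<dots> = residue S (poly_at (pcompose Q [:0, inverse q:]) t * x * y)"
    by (rule residue_mult_cong[OF q_commute_poly[OF xt] refl])
  also have "\<dots> = residue S (poly_at (pcompose Q [:0, inverse q:]) t * (x * y))"
    by (simp add: mult.assoc)
  also have "\<dots> = residue S (poly_at (pcompose Q [:0, inverse q:]) t * poly_at P t)"
    by (intro residue_mult_cong xy refl)
  finally show ?case
    using Q(2) by (intro exI[of _ "pcompose Q [:0, inverse q:] * P"])
      (simp add: poly_at_mult poly_pcompose)
qed

text \<open>The relations are symmetric in \<open>x\<close> and \<open>y\<close>, so a fact about \<open>x\<^sup>n y\<^sup>n\<close> is also one about
  \<open>y\<^sup>n x\<^sup>n\<close>.\<close>

lemma weyl_relations_swap: "weyl_relations S y x t (pcompose P [:0, q:]) (inverse q)"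
proof
  show "residue S (x * y) = residue S (poly_at (pcompose P [:0, q:]) (const (inverse q) * t))"
    using q xy by (simp add: poly_at_scale_variable const_mult_inverse_cancel)
qed (use q xy yx xt yt in \<open>auto simp: poly_at_scale_variable\<close>)

end

definition poly_combination :: "('g, 'k::field) free_algebra \<Rightarrow> ('i \<Rightarrow> ('g, 'k) free_algebra)
    \<Rightarrow> ('i \<Rightarrow>\<^sub>0 'k poly) \<Rightarrow> ('g, 'k) free_algebra"
  where "poly_combination t e F =
    (\<Sum>n\<in>Poly_Mapping.keys F. poly_at (Poly_Mapping.lookup F n) t * e n)"

lemma poly_combination_add:
  "poly_combination t e (F + G) = poly_combination t e F + poly_combination t e G"
  unfolding poly_combination_def
  by (rule setsum_keys_plus_distrib) (simp_all add: poly_at_add distrib_right)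

lemma poly_combination_sum:
  "poly_combination t e (\<Sum>i\<in>I. F i) = (\<Sum>i\<in>I. poly_combination t e (F i))"
  by (induction I rule: infinite_finite_induct)
    (simp_all add: poly_combination_add, simp_all add: poly_combination_def)

lemma poly_combination_single: "poly_combination t e (Poly_Mapping.single n f) = poly_at f t * e n"
  by (simp add: poly_combination_def)

lemma residue_poly_combination:
  assumes "\<And>w. w \<in> Poly_Mapping.keys f \<Longrightarrow>
    \<exists>g n. residue S (Poly_Mapping.single w 1) = residue S (poly_at g t * e n)"
  shows "\<exists>F. residue S f = residue S (poly_combination t e F)"
proof -
  let ?c = "Poly_Mapping.lookup f"
  from assms have "\<forall>w. \<exists>g n. w \<in> Poly_Mapping.keys f \<longrightarrow>
      residue S (Poly_Mapping.single w 1) = residue S (poly_at g t * e n)" by blast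
  then obtain g n where gn: "\<And>w. w \<in> Poly_Mapping.keys f \<Longrightarrow>
      residue S (Poly_Mapping.single w 1) = residue S (poly_at (g w) t * e (n w))" by metis
  have "f = (\<Sum>w\<in>Poly_Mapping.keys f. const (?c w) * Poly_Mapping.single w 1)"
    by (rule poly_mapping_eqI)
      (auto simp: const_def mult_single lookup_sum lookup_single when_def in_keys_iff sum.delta')
  then have "residue S f =
      residue S (\<Sum>w\<in>Poly_Mapping.keys f. const (?c w) * Poly_Mapping.single w 1)"
    by (rule arg_cong)
  also have "\<dots> = residue S (\<Sum>w\<in>Poly_Mapping.keys f. const (?c w) * (poly_at (g w) t * e (n w)))"
    by (rule residue_sum_cong, rule residue_mult_cong[OF refl gn])
  also have "\<dots> = residue S (poly_combination t e
      (\<Sum>w\<in>Poly_Mapping.keys f. Poly_Mapping.single (n w) (Polynomial.smult (?c w) (g w))))"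
    by (simp add: poly_combination_sum poly_combination_single poly_at_smult mult.assoc)
  finally show ?thesis by blast
qed


section \<open>The relations of \<open>\<A>(p; q\<^sub>\<plusminus>)\<close>\<close>

locale A_parameters =
  fixes p :: "'k::field poly" and qp qm q :: 'k and k :: nat
  assumes qp: "qp \<noteq> 0" and qm: "qm \<noteq> 0" and q_def: "q = qp * qm"
    and p: "p \<noteq> 0" and p_0: "poly p 0 = 0" and k_def: "k = Polynomial.order 0 p"
begin

abbreviation "S \<equiv> A_relations p qp qm"
abbreviation "P \<equiv> p_tilde p"
abbreviation zp :: "(A_gen, 'k) free_algebra" where "zp \<equiv> gen Azp"
abbreviation zm :: "(A_gen, 'k) free_algebra" where "zm \<equiv> gen Azm"
abbreviation xp :: "(A_gen, 'k) free_algebra" where "xp \<equiv> gen Axp"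
abbreviation xm :: "(A_gen, 'k) free_algebra" where "xm \<equiv> gen Axm"
abbreviation w :: "(A_gen, 'k) free_algebra" where "w \<equiv> zp * zm"
abbreviation "wt \<equiv> A_degree k"

lemma q: "q \<noteq> 0"
  using qp qm by (simp add: q_def)

lemma k_pos: "k > 0"
  using order_root[of p 0] p p_0 by (simp add: k_def)

lemma p_eq: "p = [:0, 1:] ^ k * P"
  using p_tilde_eq[OF p] by (simp add: k_def)

lemma P_0: "poly P 0 \<noteq> 0"
proof
  assume "poly P 0 = 0"
  then have "[:0, 1:] dvd P" by (simp add: dvd_iff_poly_eq_0)
  then have "[:0, 1:] ^ Suc k dvd p"
    by (subst p_eq) (metis dvd_refl mult.commute mult_dvd_mono power_Suc)
  then show False
    using p by (metis k_def order_2 neg_equal_zero minus_zero)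
qed

lemma A_relation: "f - g \<in> S \<Longrightarrow> residue S f = residue S g"
  by (simp add: residue_eq_iff relation_ideal_generator)

lemma q_commute_gens:
  "q_commute S 1 zp zm" "q_commute S 1 zm zp"
  "q_commute S (inverse qp) xp zp" "q_commute S (inverse qm) xp zm"
  "q_commute S qp xm zp" "q_commute S qm xm zm"
proof -
  show "q_commute S 1 zm zp"
    unfolding q_commute_def const_simps(2) mult_1
    by (rule A_relation[symmetric]) (simp add: A_relations_def Let_def)
  show "q_commute S 1 zp zm" "q_commute S (inverse qp) xp zp" "q_commute S (inverse qm) xp zm"
    "q_commute S qp xm zp" "q_commute S qm xm zm"
    unfolding q_commute_def const_simps(2) mult_1
    by (rule A_relation, simp add: A_relations_def Let_def mult.assoc)+
qed

lemma q_commute_self: "q_commute R 1 a a"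
  by (simp add: q_commute_def const_simps)

lemma q_commute_w:
  "q_commute S 1 zp w" "q_commute S 1 zm w" "q_commute S (inverse q) xp w" "q_commute S q xm w"
  using q_commute_mult_right[OF q_commute_self q_commute_gens(1)]
    q_commute_mult_right[OF q_commute_gens(2) q_commute_self]
    q_commute_mult_right[OF q_commute_gens(3,4)] q_commute_mult_right[OF q_commute_gens(5,6)]
  by (simp_all add: q_def mult.commute)

sublocale weyl_relations S xp xm w P q
proof
  show "residue S (xp * xm) = residue S (poly_at P w)"
    "residue S (xm * xp) = residue S (poly_at P (const q * w))"
    by (rule A_relation, simp add: A_relations_def Let_def q_def)+
qed (use q q_commute_w in auto)

lemma homogeneous_A_relations: "s \<in> S \<Longrightarrow> \<exists>m. s \<in> homogeneous wt m"
proof -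
  have gens: "zp \<in> homogeneous wt 1" "zm \<in> homogeneous wt (- 1)"
    "xp \<in> homogeneous wt (int k)" "xm \<in> homogeneous wt (- int k)"
    by (auto intro: homogeneous_gen)
  have w: "w \<in> homogeneous wt 0" and "zm * zp \<in> homogeneous wt 0"
    and "xp * xm \<in> homogeneous wt 0" "xm * xp \<in> homogeneous wt 0"
    using homogeneous_mult[OF gens(1,2)] homogeneous_mult[OF gens(2,1)]
      homogeneous_mult[OF gens(3,4)] homogeneous_mult[OF gens(4,3)] by simp_all
  then have "\<exists>m. zp * zm - zm * zp \<in> homogeneous wt m"
    "\<exists>m. xp * xm - poly_at P w \<in> homogeneous wt m"
    "\<exists>m. xm * xp - poly_at P (const (qp * qm) * w) \<in> homogeneous wt m"
    by (auto intro!: exI[of _ 0] homogeneous_diff homogeneous_poly_at homogeneous_scale)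
  moreover have "\<exists>l. x * y - const c * y * x \<in> homogeneous wt l"
    if "x \<in> homogeneous wt m" "y \<in> homogeneous wt n" for x y c m n
    using homogeneous_mult[OF that] homogeneous_scale[OF homogeneous_mult[OF that(2,1)], of c]
    by (intro exI[of _ "m + n"] homogeneous_diff) (simp_all add: mult.assoc add.commute)
  note this[OF gens(3,1), of "inverse qp"] this[OF gens(3,2), of "inverse qm"]
    this[OF gens(4,1), of qp] this[OF gens(4,2), of qm]
  ultimately show "s \<in> S \<Longrightarrow> \<exists>m. s \<in> homogeneous wt m"
    unfolding A_relations_def Let_def
    by (elim insertE emptyE; hypsubst) assumption+
qed

text \<open>The monomials of degree \<open>d\<close> that have degree \<open>n\<close> in \<open>x\<^sub>\<plusminus>\<close> are multiples of the shortest one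
  by powers of \<open>w\<close>, up to scalars. In the shortest one \<open>z\<^sub>+\<close> or \<open>z\<^sub>-\<close> is missing, which the
  truncation in \<^const>\<open>nat\<close> expresses.\<close>

definition A_basis :: "int \<Rightarrow> int \<Rightarrow> (A_gen, 'k) free_algebra"
  where "A_basis d n = zp ^ nat (d - n * int k) * zm ^ nat (n * int k - d) * xpow n"

lemma q_commute_monomial_w: "q_commute S 1 (zp ^ a * zm ^ b) w"
  using q_commute_mult_left[OF q_commute_power_left[OF q_commute_w(1), of a]
      q_commute_power_left[OF q_commute_w(2), of b]] by simp

lemma x_q_commute_monomial:
  "\<exists>c. q_commute S c xp (zp ^ a * zm ^ b)" "\<exists>c. q_commute S c xm (zp ^ a * zm ^ b)"
  by (rule exI, rule q_commute_mult_right[OF q_commute_power_right[OF q_commute_gens(3)]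
        q_commute_power_right[OF q_commute_gens(4)]])
    (rule exI, rule q_commute_mult_right[OF q_commute_power_right[OF q_commute_gens(5)]
        q_commute_power_right[OF q_commute_gens(6)]])

text \<open>The element \<open>x\<close> stands for \<open>x\<^sub>+\<close> or \<open>x\<^sub>-\<close>. It moves past the monomial in \<open>z\<^sub>\<plusminus>\<close> up to a
  scalar; the polynomial in \<open>w\<close> that may arise from \<open>x\<^sub>+x\<^sub>-\<close> or \<open>x\<^sub>-x\<^sub>+\<close> moves back to the left.\<close>

lemma x_A_basis:
  assumes x: "\<exists>c. q_commute S c x (zp ^ a * zm ^ b)"
    and "\<exists>f. residue S (x * xpow n) = residue S (poly_at f w * xpow n')"
  shows "\<exists>f. residue S (x * (zp ^ a * zm ^ b * xpow n)) =
    residue S (poly_at f w * (zp ^ a * zm ^ b * xpow n'))"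
proof -
  let ?Z = "zp ^ a * zm ^ b"
  obtain c f where c: "q_commute S c x ?Z"
    and f: "residue S (x * xpow n) = residue S (poly_at f w * xpow n')" using assms by blast
  have "residue S (x * (?Z * xpow n)) = residue S (x * ?Z * xpow n)" by (simp only: mult.assoc)
  also have "\<dots> = residue S (const c * (?Z * x) * xpow n)"
    by (rule residue_mult_cong[OF q_commuteD[OF c] refl])
  also have "\<dots> = residue S (const c * ?Z * (x * xpow n))" by (simp only: mult.assoc)
  also have "\<dots> = residue S (const c * ?Z * (poly_at f w * xpow n'))"
    by (rule residue_mult_cong[OF refl f])
  also have "\<dots> = residue S (const c * (?Z * poly_at f w * xpow n'))" by (simp only: mult.assoc)
  also have "\<dots> = residue S (const c * (poly_at f w * ?Z * xpow n'))"
    by (intro residue_mult_cong[OF refl] residue_mult_cong[OF _ refl] q_commute_1_poly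
        q_commute_monomial_w)
  also have "\<dots> = residue S (poly_at (Polynomial.smult c f) w * (?Z * xpow n'))"
    by (simp only: poly_at_smult mult.assoc)
  finally show ?thesis by blast
qed

primrec A_xdegree :: "A_gen \<Rightarrow> int" where
  "A_xdegree Azp = 0" | "A_xdegree Azm = 0" | "A_xdegree Axp = 1" | "A_xdegree Axm = - 1"

lemma gen_A_basis: "\<exists>f. residue S (gen g * A_basis d n) =
  residue S (poly_at f w * A_basis (d + wt g) (n + A_xdegree g))"
proof (cases g)
  case Azp
  show ?thesis
  proof (cases "d - n * int k \<ge> 0")
    case True
    then have "nat (d + 1 - n * int k) = Suc (nat (d - n * int k))" "nat (n * int k - d) = 0"
      "nat (n * int k - (d + 1)) = 0" by auto
    then have "zp * A_basis d n = poly_at 1 w * A_basis (d + 1) n"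
      by (simp add: A_basis_def mult.assoc)
    with Azp show ?thesis by (intro exI[of _ 1]) simp
  next
    case False
    then have "nat (n * int k - d) = Suc (nat (n * int k - (d + 1)))" by simp
    with False have "zp * A_basis d n = poly_at [:0, 1:] w * A_basis (d + 1) n"
      by (simp add: A_basis_def mult.assoc poly_at_X)
    with Azp show ?thesis by (intro exI[of _ "[:0, 1:]"]) simp
  qed
next
  case Azm
  show ?thesis
  proof (cases "d - n * int k > 0")
    case True
    then have "nat (d - n * int k) = Suc (nat (d - 1 - n * int k))" by simp
    with True have "zm * A_basis d n = zm * zp * A_basis (d - 1) n"
      by (simp add: A_basis_def mult.assoc)
    with Azm residue_mult_cong[OF q_commuteD[OF q_commute_gens(2)] refl, of "A_basis (d - 1) n"]
    show ?thesis by (intro exI[of _ "[:0, 1:]"]) (simp add: poly_at_X const_simps)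
  next
    case False
    then have "nat (n * int k - (d - 1)) = Suc (nat (n * int k - d))" by simp
    with False have "zm * A_basis d n = poly_at 1 w * A_basis (d - 1) n"
      by (simp add: A_basis_def mult.assoc)
    with Azm show ?thesis by (intro exI[of _ 1]) simp
  qed
next
  case Axp
  have "A_basis (d + int k) (n + 1) =
      zp ^ nat (d - n * int k) * zm ^ nat (n * int k - d) * xpow (n + 1)"
    by (simp add: A_basis_def algebra_simps)
  with x_A_basis[OF x_q_commute_monomial(1) x_xpow[of n]] show ?thesis
    by (simp only: Axp A_degree.simps A_xdegree.simps A_basis_def[of d n])
next
  case Axm
  have "A_basis (d + - int k) (n + - 1) =
      zp ^ nat (d - n * int k) * zm ^ nat (n * int k - d) * xpow (n - 1)"
    by (simp add: A_basis_def algebra_simps)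
  with x_A_basis[OF x_q_commute_monomial(2) y_xpow[of n]] show ?thesis
    by (simp only: Axm A_degree.simps A_xdegree.simps A_basis_def[of d n])
qed

lemma gen_poly_A_basis: "\<exists>f'. residue S (gen g * (poly_at f w * A_basis d n)) =
  residue S (poly_at f' w * A_basis (d + wt g) (n + A_xdegree g))"
proof -
  obtain c where "q_commute S c (gen g) w"
    using q_commute_w by (cases g) blast+
  then show ?thesis by (rule mult_poly_at_mult) (rule gen_A_basis)
qed

lemma A_normal_form_word:
  "\<exists>f n. residue S (Poly_Mapping.single (Word ws) 1) =
    residue S (poly_at f w * A_basis (\<Sum>g\<leftarrow>ws. wt g) n)"
proof (induction ws)
  case Nil
  have "(Poly_Mapping.single (Word []) 1 :: (A_gen, 'k) free_algebra) = poly_at 1 w * A_basis 0 0"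
    by (simp add: A_basis_def xpow_0 zero_free_monoid_def[symmetric])
  then show ?case by (intro exI[of _ 1] exI[of _ 0]) simp
next
  case (Cons g ws)
  then obtain f n where IH: "residue S (Poly_Mapping.single (Word ws) 1) =
    residue S (poly_at f w * A_basis (\<Sum>g\<leftarrow>ws. wt g) n)" by blast
  have "(Poly_Mapping.single (Word (g # ws)) 1 :: (A_gen, 'k) free_algebra) = gen g * Poly_Mapping.single (Word ws) 1"
    by (simp add: gen_def mult_single plus_free_monoid_def)
  then have "residue S (Poly_Mapping.single (Word (g # ws)) 1) =
      residue S (gen g * (poly_at f w * A_basis (\<Sum>g\<leftarrow>ws. wt g) n))"
    using residue_mult_cong[OF refl IH, of "gen g"] by simp
  then show ?case
    using gen_poly_A_basis[of g f "\<Sum>g\<leftarrow>ws. wt g" n] by (auto simp: add.commute)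
qed

lemma A_normal_form:
  assumes "f \<in> homogeneous wt d"
  obtains F where "residue S f = residue S (poly_combination w (A_basis d) F)"
proof -
  have "\<exists>g n. residue S (Poly_Mapping.single u 1) = residue S (poly_at g w * A_basis d n)"
    if "u \<in> Poly_Mapping.keys f" for u
    using A_normal_form_word[of "letters u"] that assms by (auto simp: homogeneous_def)
  then show thesis
    using residue_poly_combination[of f S w "A_basis d"] that by blast
qed


section \<open>A representation of \<open>\<A>(p; q\<^sub>\<plusminus>)\<close>\<close>

text \<open>\<open>\<A>(p; q\<^sub>\<plusminus>)\<close> acts on Laurent series in a variable \<open>s\<close> over \<open>\<K>[w]\<close>, infinite in both
  directions, where \<open>v n\<close> is the coefficient of \<open>s\<^sup>n\<close>. The element \<open>x\<^sub>-\<close> acts as \<open>s\<^sup>-\<^sup>1\<close>, which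
  rescales \<open>w\<close>, and \<open>z\<^sub>+\<close> is diagonal. The operators of \<open>x\<^sub>+\<close> and \<open>z\<^sub>-\<close> are then forced by
  \<open>x\<^sub>+x\<^sub>- = P(w)\<close> and \<open>z\<^sub>+z\<^sub>- = w\<close>. Only the two variables \<open>w\<close> and \<open>s\<close> are left, but elements
  of a fixed degree can still be told apart.\<close>

primrec A_operator :: "A_gen \<Rightarrow> (int \<Rightarrow> 'k poly) \<Rightarrow> int \<Rightarrow> 'k poly" where
  "A_operator Azp v = (\<lambda>n. Polynomial.smult (qp powi n) (v n))"
| "A_operator Azm v = (\<lambda>n. Polynomial.smult (qp powi (- n)) ([:0, 1:] * v n))"
| "A_operator Axp v = (\<lambda>n. P * pcompose (v (n - 1)) [:0, inverse q:])"
| "A_operator Axm v = (\<lambda>n. pcompose (v (n + 1)) [:0, q:])"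

sublocale A_action: free_algebra_action
  "\<lambda>c (v :: int \<Rightarrow> 'k poly) n. Polynomial.smult c (v n)" A_operator
proof
  show "A_operator g (u + v) = A_operator g u + A_operator g v" for g u v
    by (cases g)
      (auto simp: fun_eq_iff smult_add_right distrib_left pcompose_add)
  show "A_operator g (\<lambda>n. Polynomial.smult c (v n)) = (\<lambda>n. Polynomial.smult c (A_operator g v n))"
    for g c v
    by (cases g) (auto simp: fun_eq_iff pcompose_smult mult.commute)
qed (auto simp: fun_eq_iff smult_add_right smult_add_left)

lemma act_poly_at:
  assumes "\<And>v. A_action.act a v = (\<lambda>n. t * v n)"
  shows "A_action.act (poly_at f a) v = (\<lambda>n. pcompose f t * v n)"
proof (induction f)
  case 0
  show ?case by (simp add: fun_eq_iff)
next
  case (pCons c f)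
  then show ?case
    by (simp add: poly_at_pCons pcompose_pCons A_action.act_add A_action.act_mult assms
      distrib_right mult.assoc fun_eq_iff)
qed

lemma act_w: "A_action.act w v = (\<lambda>n. [:0, 1:] * v n)"
  using qp by (simp add: A_action.act_mult fun_eq_iff power_int_minus)

lemma act_poly_w: "A_action.act (poly_at f w) v = (\<lambda>n. f * v n)"
  by (simp add: act_poly_at[OF act_w] pcompose_idR)

lemma pcompose_scale_scale:
  "pcompose (pcompose f [:0, a:]) [:0, b:] = pcompose f [:0, a * b:]"
  by (subst pcompose_assoc[symmetric]) (simp add: pcompose_pCons mult.commute)

lemma pcompose_scale_eq_0_iff: "(c :: 'c::idom) \<noteq> 0 \<Longrightarrow> pcompose f [:0, c:] = 0 \<longleftrightarrow> f = 0"
  using pcompose_eq_0[of f "[:0, c:]"] by auto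

lemma act_relation:
  assumes "s \<in> S" shows "A_action.act s v = 0"
proof -
  have qw: "A_action.act (const q * w) v = (\<lambda>n. [:0, q:] * v n)" for v
    unfolding A_action.act_mult[of "const q"] act_w by (simp add: fun_eq_iff)
  have shift: "qp powi (n + 1) = qp powi n * qp" "qp powi (n - 1) = qp powi n * inverse qp"
    "qp powi (1 - n) = qp * inverse (qp powi n)" "qp powi (- n) = inverse (qp powi n)"
    "qp powi (- n - 1) = inverse (qp powi n) * inverse qp" for n
    using qp by (simp_all add: power_int_add power_int_diff power_int_minus divide_inverse)
  have scalars: "inverse c * qp * inverse q = inverse qm * inverse c"
    "inverse c * inverse qp * q = qm * inverse c" for c
    using qp qm by (simp_all add: q_def)
  have "A_action.act s v n = 0" for n
    using assms unfolding A_relations_def Let_def q_def[symmetric]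
    by (elim insertE emptyE; hypsubst)
      (use q in \<open>simp_all add: A_action.act_minus act_poly_at[OF act_w] act_poly_at[OF qw]
        A_action.act_mult pcompose_smult pcompose_pCons pcompose_mult
        pcompose_scale_scale pcompose_idR shift scalars\<close>,
       (rule arg_cong2[of _ _ _ _ Polynomial.smult, OF mult.commute refl])+)
  then show ?thesis by (simp add: fun_eq_iff)
qed

lemma act_cong:
  assumes "residue S f = residue S g" shows "A_action.act f v = A_action.act g v"
proof -
  have "A_action.act (f - g) v \<in> {0}"
  proof (rule A_action.act_relation_ideal)
    show "A_operator h u \<in> {0}" if "u \<in> {0}" for h u
      using that by (cases h) (simp_all add: fun_eq_iff)
    show "(\<lambda>n. Polynomial.smult c (u n)) \<in> {0}" if "u \<in> {0}" for c u
      using that by (simp add: fun_eq_iff)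
    show "f - g \<in> relation_ideal S" using assms by (simp add: residue_eq_iff)
    show "A_action.act s u \<in> {0}" if "s \<in> S" for s u
      using act_relation[OF that] by blast
  qed simp_all
  then show ?thesis by (simp add: A_action.act_minus)
qed

text \<open>The polynomial by which a power of \<open>x\<^sub>+\<close> or \<open>x\<^sub>-\<close> multiplies the monomial that it shifts.
  Only positive powers contribute factors \<open>P\<close>.\<close>

primrec xp_factor :: "nat \<Rightarrow> 'k poly" where
  "xp_factor 0 = 1"
| "xp_factor (Suc n) = P * pcompose (xp_factor n) [:0, inverse q:]"

definition x_factor :: "int \<Rightarrow> 'k poly"
  where "x_factor n = (if n \<ge> 0 then xp_factor (nat n) else 1)"

lemma P_nonzero: "P \<noteq> 0"
  using P_0 by auto

lemma xp_factor_nonzero: "xp_factor n \<noteq> 0"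
  using q P_nonzero by (induction n) (simp_all add: pcompose_scale_eq_0_iff)

lemma degree_x_factor:
  assumes "Polynomial.degree P > 0" "Polynomial.degree (x_factor n) = 0"
  shows "n \<le> 0"
proof (rule ccontr)
  assume "\<not> n \<le> 0"
  then have n: "x_factor n = P * pcompose (xp_factor (nat n - 1)) [:0, inverse q:]"
    by (cases "nat n") (simp_all add: x_factor_def)
  moreover have "pcompose (xp_factor (nat n - 1)) [:0, inverse q:] \<noteq> 0"
    using q xp_factor_nonzero[of "nat n - 1"] by (simp add: pcompose_scale_eq_0_iff)
  ultimately show False using assms P_nonzero by (simp add: degree_mult_eq)
qed

lemma x_factor_nonzero: "x_factor n \<noteq> 0"
  by (simp add: x_factor_def xp_factor_nonzero)

text \<open>The monomial \<open>h s\<^sup>c\<close>.\<close>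

definition delta :: "int \<Rightarrow> 'k poly \<Rightarrow> int \<Rightarrow> 'k poly"
  where "delta c h = (\<lambda>n. if n = c then h else 0)"

lemma act_zp_power: "A_action.act (zp ^ a) (delta c h) = delta c (Polynomial.smult ((qp powi c) ^ a) h)"
  by (induction a) (auto simp: A_action.act_mult delta_def fun_eq_iff)

lemma act_zm_power: "A_action.act (zm ^ b) (delta c h) =
    delta c (Polynomial.smult ((qp powi (- c)) ^ b) ([:0, 1:] ^ b * h))"
  by (induction b) (auto simp: A_action.act_mult delta_def fun_eq_iff mult.assoc)

lemma act_xp_power: "A_action.act (xp ^ n) (delta c h) =
    delta (c + int n) (xp_factor n * pcompose h [:0, inverse q ^ n:])"
  by (induction n)
    (auto simp: A_action.act_mult delta_def fun_eq_iff pcompose_mult pcompose_scale_scale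
      pcompose_idR mult.assoc mult.commute[of "inverse q"])

lemma act_xm_power: "A_action.act (xm ^ n) (delta c h) =
    delta (c - int n) (pcompose h [:0, q ^ n:])"
  by (induction n)
    (auto simp: A_action.act_mult delta_def fun_eq_iff pcompose_scale_scale pcompose_idR
      mult.commute[of q])

lemma act_xpow: "A_action.act (xpow n) (delta c h) =
    delta (c + n) (x_factor n * pcompose h [:0, q powi (- n):])"
  by (simp add: xpow_def x_factor_def act_xp_power act_xm_power power_int_def)

text \<open>The terms of a normal form shift a monomial by different amounts. The scalars that arise do not
  depend on \<open>h\<close> or on the coefficients \<open>F\<close>; all that matters about them is that they are not zero.\<close>

lemma act_poly_combination:
  obtains s where "\<And>c n. s c n \<noteq> 0"
    "\<And>F c h. A_action.act (poly_combination w (A_basis d) F) (delta c h) =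
      (\<Sum>n\<in>Poly_Mapping.keys F. delta (c + n) (Polynomial.smult (s c n)
        (Poly_Mapping.lookup F n * [:0, 1:] ^ nat (n * int k - d) * x_factor n *
          pcompose h [:0, q powi (- n):])))"
proof
  let ?s = "\<lambda>c n. (qp powi (c + n)) ^ nat (d - n * int k) *
      (qp powi (- (c + n))) ^ nat (n * int k - d)"
  show "?s c n \<noteq> 0" for c n using qp by simp
  show "A_action.act (poly_combination w (A_basis d) F) (delta c h) =
      (\<Sum>n\<in>Poly_Mapping.keys F. delta (c + n) (Polynomial.smult (?s c n)
        (Poly_Mapping.lookup F n * [:0, 1:] ^ nat (n * int k - d) * x_factor n *
          pcompose h [:0, q powi (- n):])))" for F c h
    unfolding poly_combination_def A_action.act_sum
  proof (rule sum.cong[OF refl])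
    fix n
    show "A_action.act (poly_at (Poly_Mapping.lookup F n) w * A_basis d n) (delta c h) =
      delta (c + n) (Polynomial.smult (?s c n)
        (Poly_Mapping.lookup F n * [:0, 1:] ^ nat (n * int k - d) * x_factor n *
          pcompose h [:0, q powi (- n):]))"
      by (simp add: A_basis_def A_action.act_mult act_poly_w act_xpow act_zp_power act_zm_power)
        (simp add: delta_def fun_eq_iff mult_ac)
  qed
qed

lemma sum_fun_apply: "(\<Sum>i\<in>I. F i) x = (\<Sum>i\<in>I. F i x)" for F :: "'i \<Rightarrow> 'a \<Rightarrow> 'b::comm_monoid_add"
  by (induction I rule: infinite_finite_induct) simp_all

text \<open>When the combination acts on the constant series \<open>1\<close>, its terms land in different powers of
  \<open>s\<close>.\<close>

lemma A_basis_independent: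
  assumes "residue S (poly_combination w (A_basis d) F) = residue S 0"
  shows "F = 0"
proof (rule ccontr)
  assume "F \<noteq> 0"
  then obtain m where m: "m \<in> Poly_Mapping.keys F" by (metis poly_mapping_eqI in_keys_iff lookup_zero)
  obtain s where s: "\<And>c n. s c n \<noteq> 0"
    and act: "\<And>F c h. A_action.act (poly_combination w (A_basis d) F) (delta c h) =
      (\<Sum>n\<in>Poly_Mapping.keys F. delta (c + n) (Polynomial.smult (s c n)
        (Poly_Mapping.lookup F n * [:0, 1:] ^ nat (n * int k - d) * x_factor n *
          pcompose h [:0, q powi (- n):])))"
    using act_poly_combination[of d] by blast
  have "0 = A_action.act (poly_combination w (A_basis d) F) (delta 0 1) m"
    using act_cong[OF assms, of "delta 0 1"] by simp
  also have "\<dots> = Polynomial.smult (s 0 m)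
      (Poly_Mapping.lookup F m * [:0, 1:] ^ nat (m * int k - d) * x_factor m)"
    unfolding act using m by (simp add: sum_fun_apply delta_def pcompose_1)
  finally show False
    using m s x_factor_nonzero by (simp add: in_keys_iff)
qed

end

section \<open>Homogeneous units\<close>

text \<open>\<open>M\<close> and \<open>N\<close> are the exponents of two Laurent polynomials and \<open>T m n\<close> is the product of their
  terms of exponents \<open>m\<close> and \<open>n\<close>. The highest terms meet no other pair, and neither do the lowest
  ones; so if the product has exponent \<open>0\<close> only, then both sums of exponents are \<open>0\<close>.\<close>

lemma monomial_product_imp_singletons:
  fixes T :: "int \<Rightarrow> int \<Rightarrow> 'a::comm_monoid_add"
  assumes fin: "finite M" "finite N"
    and T: "\<And>m n. m \<in> M \<Longrightarrow> n \<in> N \<Longrightarrow> T m n \<noteq> 0"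
    and sum: "\<And>j. (\<Sum>n\<in>N. \<Sum>m\<in>M. if j = n + m then T m n else 0) = (if j = 0 then e else 0)"
    and e: "e \<noteq> 0"
  obtains m where "M = {m}" "N = {- m}" "T m (- m) = e"
proof -
  have ne: "M \<noteq> {}" "N \<noteq> {}" using sum[of 0] e by auto
  have extreme: "m + n = 0 \<and> T m n = e"
    if mn: "m \<in> M" "n \<in> N"
      and unique: "\<And>m' n'. m' \<in> M \<Longrightarrow> n' \<in> N \<Longrightarrow> n' + m' = n + m \<Longrightarrow> m' = m \<and> n' = n" for m n
  proof -
    have "(\<Sum>n'\<in>N. \<Sum>m'\<in>M. if n + m = n' + m' then T m' n' else 0) =
        (\<Sum>n'\<in>N. \<Sum>m'\<in>M. if n' = n then (if m' = m then T m n else 0) else 0)"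
    proof (intro sum.cong refl)
      fix m' n' assume "n' \<in> N" "m' \<in> M"
      then show "(if n + m = n' + m' then T m' n' else 0) =
          (if n' = n then (if m' = m then T m n else 0) else 0)"
        using unique[of m' n'] by auto
    qed
    also have "\<dots> = (\<Sum>n'\<in>N. if n' = n then T m n else 0)"
      using fin mn by (intro sum.cong refl) auto
    also have "\<dots> = T m n" using fin mn by simp
    finally have "T m n = (if n + m = 0 then e else 0)" using sum[of "n + m"] by simp
    with T[OF mn] show ?thesis by (auto split: if_splits)
  qed
  have max: "Max M + Max N = 0 \<and> T (Max M) (Max N) = e"
    using fin ne by (intro extreme) (auto, (smt (verit) Max_ge)+)
  have min: "Min M + Min N = 0"
    using fin ne by (intro conjunct1[OF extreme]) (auto, (smt (verit) Min_le)+)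
  have M: "m = Max M" if "m \<in> M" for m
    using Max_ge[OF fin(1) that] Min_le[OF fin(1) that] max min Min_le[OF fin(2) Max_in[OF fin(2) ne(2)]]
    by linarith
  have N: "n = Max N" if "n \<in> N" for n
    using Max_ge[OF fin(2) that] Min_le[OF fin(2) that] max min Min_le[OF fin(1) Max_in[OF fin(1) ne(1)]]
    by linarith
  have "M = {Max M}" using M Max_in[OF fin(1) ne(1)] by blast
  moreover have "N = {Max N}" using N Max_in[OF fin(2) ne(2)] by blast
  moreover have "Max N = - Max M" using max by simp
  ultimately show thesis using that max by metis
qed

context A_parameters
begin

text \<open>Let both factors act on the constant series \<open>1\<close>. The result is a single term whose coefficient is constant, so
  all the polynomial factors are constant: the powers of \<open>w\<close> and the factors coming from \<open>x\<^sub>\<plusminus>\<close>,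
  for \<open>u\<close> as well as for \<open>v\<close>.\<close>

lemma homogeneous_unit_degree:
  assumes u: "u \<in> homogeneous wt d" and v: "v \<in> homogeneous wt (- d)"
    and uv: "residue S (u * v) = residue S 1" and P: "Polynomial.degree P > 0"
  shows "d = 0"
proof -
  obtain F where F: "residue S u = residue S (poly_combination w (A_basis d) F)"
    using A_normal_form[OF u] .
  obtain H where H: "residue S v = residue S (poly_combination w (A_basis (- d)) H)"
    using A_normal_form[OF v] .
  obtain s where s: "\<And>c n. s c n \<noteq> 0"
    and act_F: "\<And>F c h. A_action.act (poly_combination w (A_basis d) F) (delta c h) =
      (\<Sum>n\<in>Poly_Mapping.keys F. delta (c + n) (Polynomial.smult (s c n)
        (Poly_Mapping.lookup F n * [:0, 1:] ^ nat (n * int k - d) * x_factor n *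
          pcompose h [:0, q powi (- n):])))"
    using act_poly_combination[of d] by blast
  obtain t where t: "\<And>c n. t c n \<noteq> 0"
    and act_H: "\<And>F c h. A_action.act (poly_combination w (A_basis (- d)) F) (delta c h) =
      (\<Sum>n\<in>Poly_Mapping.keys F. delta (c + n) (Polynomial.smult (t c n)
        (Poly_Mapping.lookup F n * [:0, 1:] ^ nat (n * int k - (- d)) * x_factor n *
          pcompose h [:0, q powi (- n):])))"
    using act_poly_combination[of "- d"] by blast
  (* The image of delta 0 1 under v has the terms delta n (V n), and the m-th term of u sends
     delta n (V n) to delta (n + m) (T m n). *)
  define V where "V n = Polynomial.smult (t 0 n)
    (Poly_Mapping.lookup H n * [:0, 1:] ^ nat (n * int k + d) * x_factor n)" for n
  define T where "T m n = Polynomial.smult (s n m)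
    (Poly_Mapping.lookup F m * [:0, 1:] ^ nat (m * int k - d) * x_factor m *
      pcompose (V n) [:0, q powi (- m):])" for m n
  have V: "V n \<noteq> 0" if "n \<in> Poly_Mapping.keys H" for n
    using that t x_factor_nonzero by (simp add: V_def in_keys_iff)
  have V': "pcompose (V n) [:0, q powi (- m):] \<noteq> 0" if "n \<in> Poly_Mapping.keys H" for m n
    using V[OF that] q by (simp add: pcompose_scale_eq_0_iff)
  have T: "T m n \<noteq> 0" if "m \<in> Poly_Mapping.keys F" "n \<in> Poly_Mapping.keys H" for m n
    using that s x_factor_nonzero V' by (simp add: T_def in_keys_iff)
  have "A_action.act v (delta 0 1) = (\<Sum>n\<in>Poly_Mapping.keys H. delta n (V n))"
    using act_cong[OF H] by (simp add: act_H V_def pcompose_1)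
  then have "A_action.act (u * v) (delta 0 1) =
      (\<Sum>n\<in>Poly_Mapping.keys H. \<Sum>m\<in>Poly_Mapping.keys F. delta (n + m) (T m n))"
    using act_cong[OF F] by (simp add: A_action.act_mult A_action.act_sum_right act_F T_def)
  moreover have "A_action.act (u * v) (delta 0 1) = delta 0 1"
    using act_cong[OF uv] by simp
  ultimately have "(\<Sum>n\<in>Poly_Mapping.keys H. \<Sum>m\<in>Poly_Mapping.keys F. delta (n + m) (T m n) j) =
      delta 0 1 j" for j
    by (metis (no_types, lifting) sum_fun_apply sum.cong)
  then have sum: "(\<Sum>n\<in>Poly_Mapping.keys H. \<Sum>m\<in>Poly_Mapping.keys F.
      if j = n + m then T m n else 0) = (if j = 0 then 1 else 0)" for j
    by (simp add: delta_def)
  obtain m where m: "Poly_Mapping.keys F = {m}" "Poly_Mapping.keys H = {- m}" "T m (- m) = 1"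
    by (rule monomial_product_imp_singletons[OF _ _ T sum]) auto
  have nonzero: "Poly_Mapping.lookup F m \<noteq> 0" "Poly_Mapping.lookup H (- m) \<noteq> 0"
    using m(1,2) by (simp_all flip: in_keys_iff)
  have "Polynomial.degree (T m (- m)) = 0" using m(3) by simp
  then have "nat (m * int k - d) = 0" "Polynomial.degree (x_factor m) = 0"
    "Polynomial.degree (V (- m)) = 0"
    using s nonzero x_factor_nonzero V'[of "- m" m] m(2) q
    by (simp_all add: T_def degree_mult_eq degree_power_eq degree_pcompose)
  moreover from this(3) have "nat (- m * int k + d) = 0" "Polynomial.degree (x_factor (- m)) = 0"
    using t nonzero x_factor_nonzero by (simp_all add: V_def degree_mult_eq degree_power_eq)
  ultimately have "m \<le> 0" "- m \<le> 0" "nat (m * int k - d) = 0" "nat (- m * int k + d) = 0"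
    using degree_x_factor[OF P] by blast+
  then show "d = 0" by auto
qed

end


section \<open>Substitution homomorphisms\<close>

definition substitute :: "('g \<Rightarrow> ('h, 'k::field) free_algebra) \<Rightarrow> ('g, 'k) free_algebra
    \<Rightarrow> ('h, 'k) free_algebra"
  where "substitute \<phi> f = free_algebra_action.act (\<lambda>c v. const c * v) (\<lambda>g v. \<phi> g * v) f 1"

text \<open>Letting each generator \<open>g\<close> act as left multiplication by \<open>\<phi> g\<close> makes the target a
  representation, and the image of an element is what it does to \<open>1\<close>.\<close>

locale substitution =
  fixes \<phi> :: "'g \<Rightarrow> ('h, 'k::field) free_algebra"
begin

sublocale free_algebra_action "\<lambda>c (v :: ('h, 'k) free_algebra). const c * v" "\<lambda>g v. \<phi> g * v"
  by unfold_locales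
    (simp_all add: distrib_left distrib_right const_simps mult.assoc mult_const_left_commute[of "\<phi> _"])

lemma act_eq: "act f v = substitute \<phi> f * v"
proof -
  have word: "foldr (\<lambda>g v. \<phi> g * v) ws v = foldr (\<lambda>g v. \<phi> g * v) ws 1 * v" for ws v
    by (induction ws) (simp_all add: mult.assoc)
  have "act f v = act f 1 * v"
  proof (induction f rule: free_algebra_induct)
    case (add w c f)
    show ?case
      unfolding act_add act_single distrib_right add.IH
      by (subst word) (simp only: mult.assoc)
  qed simp
  then show ?thesis by (simp add: substitute_def)
qed

lemma substitute_add: "substitute \<phi> (f + g) = substitute \<phi> f + substitute \<phi> g"
  by (simp add: substitute_def act_add)

lemma substitute_minus: "substitute \<phi> (f - g) = substitute \<phi> f - substitute \<phi> g"
  by (simp add: substitute_def act_minus)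

lemma substitute_sum: "substitute \<phi> (\<Sum>i\<in>I. F i) = (\<Sum>i\<in>I. substitute \<phi> (F i))"
  by (simp add: substitute_def act_sum)

lemma substitute_mult: "substitute \<phi> (f * g) = substitute \<phi> f * substitute \<phi> g"
proof -
  have "act (f * g) 1 = act f (act g 1)" by (rule act_mult)
  then show ?thesis by (simp add: act_eq)
qed

lemma substitute_gen: "substitute \<phi> (gen g) = \<phi> g"
  by (simp add: substitute_def)

lemma substitute_const: "substitute \<phi> (const c) = const c"
  by (simp add: substitute_def)

lemma substitute_one: "substitute \<phi> 1 = 1"
  by (simp add: substitute_def)

lemma substitute_power: "substitute \<phi> (f ^ n) = substitute \<phi> f ^ n"
  by (induction n) (simp_all add: substitute_mult substitute_one)

lemma substitute_poly_at: "substitute \<phi> (poly_at p f) = poly_at p (substitute \<phi> f)"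
  unfolding poly_at_def
  by (simp add: substitute_sum substitute_mult substitute_const substitute_power)

lemma substitute_relation_ideal:
  assumes "\<And>s. s \<in> R \<Longrightarrow> substitute \<phi> s \<in> relation_ideal S" and f: "f \<in> relation_ideal R"
  shows "substitute \<phi> f \<in> relation_ideal S"
proof -
  have "act f 1 \<in> relation_ideal S"
    by (rule act_relation_ideal[OF _ _ _ _ _ f])
      (auto simp: act_eq relation_ideal_0 relation_ideal_add relation_ideal_mult_left
        relation_ideal_mult_right assms(1))
  then show ?thesis by (simp add: act_eq)
qed

end


section \<open>The degree-zero part is \<open>\<B>(p; q, 0)\<close>\<close>

lemma const_mult_power: "(const c * f) ^ n = const (c ^ n) * f ^ n"
proof (induction n)
  case (Suc n)
  have "(const c * f) ^ Suc n = const c * (f * (const (c ^ n) * f ^ n))"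
    by (simp add: Suc.IH mult.assoc)
  also have "f * (const (c ^ n) * f ^ n) = const (c ^ n) * (f * f ^ n)"
    by (rule mult_const_left_commute)
  finally show ?case by (simp add: const_simps mult.assoc)
qed (simp add: const_simps)

text \<open>The scalar is a power of \<open>c\<close>; that it is \<open>1\<close> for \<open>c = 1\<close> is needed for \<open>z\<^sub>+z\<^sub>-\<close>.\<close>

lemma residue_power_q_commute:
  assumes "q_commute S c b a" "c \<noteq> 0"
  shows "\<exists>c'. c' \<noteq> 0 \<and> (c = 1 \<longrightarrow> c' = 1) \<and> residue S ((a * b) ^ n) = residue S (const c' * (a ^ n * b ^ n))"
proof (induction n)
  case 0
  show ?case by (intro exI[of _ 1]) (simp add: const_simps)
next
  case (Suc n)
  then obtain c' where c': "c' \<noteq> 0" "c = 1 \<longrightarrow> c' = 1"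
    "residue S ((a * b) ^ n) = residue S (const c' * (a ^ n * b ^ n))" by blast
  have "residue S ((a * b) ^ Suc n) = residue S (a * b * (const c' * (a ^ n * b ^ n)))"
    unfolding power_Suc by (rule residue_mult_cong[OF refl c'(3)])
  also have "a * b * (const c' * (a ^ n * b ^ n)) = const c' * a * ((b * a ^ n) * b ^ n)"
    by (simp add: mult.assoc mult_const_left_commute[of a] mult_const_left_commute[of b])
  also have "residue S \<dots> = residue S (const c' * a * ((const (c ^ n) * (a ^ n * b)) * b ^ n))"
    by (intro residue_mult_cong[OF refl] residue_mult_cong[OF _ refl]
        q_commuteD q_commute_power_right assms(1))
  also have "const c' * a * ((const (c ^ n) * (a ^ n * b)) * b ^ n) =
      const (c' * c ^ n) * (a ^ Suc n * b ^ Suc n)"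
    by (simp add: mult.assoc const_simps mult_const_left_commute[of a])
  finally show ?case using c'(1,2) assms(2) by (intro exI[of _ "c' * c ^ n"]) simp
qed

context A_parameters
begin

lemma w_power: "residue S (zp ^ n * zm ^ n) = residue S (w ^ n)"
  using residue_power_q_commute[OF q_commute_gens(2), of n] by (auto simp: const_simps)

abbreviation "S' \<equiv> B_relations p q 0"
abbreviation x :: "(B_gen, 'k) free_algebra" where "x \<equiv> gen Bx"
abbreviation y :: "(B_gen, 'k) free_algebra" where "y \<equiv> gen By"
abbreviation z :: "(B_gen, 'k) free_algebra" where "z \<equiv> gen Bz"

lemma B_relation: "f - g \<in> S' \<Longrightarrow> residue S' f = residue S' g"
  by (simp add: residue_eq_iff relation_ideal_generator)

sublocale B: weyl_relations S' y x z p q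
proof
  show "residue S' (y * x) = residue S' (poly_at p z)"
    "residue S' (x * y) = residue S' (poly_at p (const q * z))"
    by (rule B_relation, simp add: B_relations_def Let_def const_simps)+
  show "q_commute S' (inverse q) y z" "q_commute S' q x z"
    unfolding q_commute_def
    by (rule B_relation, simp add: B_relations_def Let_def const_simps mult.assoc)+
qed (rule q)

lemma gen_poly_B_basis:
  "\<exists>f' n'. residue S' (gen g * (poly_at f z * B.xpow n)) = residue S' (poly_at f' z * B.xpow n')"
proof (cases g)
  case Bz
  then have "gen g * (poly_at f z * B.xpow n) = poly_at ([:0, 1:] * f) z * B.xpow n"
    unfolding poly_at_mult poly_at_X by (simp add: mult.assoc)
  then show ?thesis by (intro exI[of _ "[:0, 1:] * f"] exI[of _ n]) simp
next
  case By
  with mult_poly_at_mult[OF B.xt B.x_xpow] show ?thesis by blast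
next
  case Bx
  with mult_poly_at_mult[OF B.yt B.y_xpow] show ?thesis by blast
qed

lemma B_normal_form_word: "\<exists>f n. residue S' (Poly_Mapping.single (Word ws) 1) =
    residue S' (poly_at f z * B.xpow n)"
proof (induction ws)
  case Nil
  have "(Poly_Mapping.single (Word []) 1 :: (B_gen, 'k) free_algebra) = poly_at 1 z * B.xpow 0"
    by (simp add: B.xpow_0 zero_free_monoid_def[symmetric])
  then show ?case by (intro exI[of _ 1] exI[of _ 0]) simp
next
  case (Cons g ws)
  then obtain f n where IH: "residue S' (Poly_Mapping.single (Word ws) 1) =
    residue S' (poly_at f z * B.xpow n)" by blast
  have "(Poly_Mapping.single (Word (g # ws)) 1 :: (B_gen, 'k) free_algebra) =
      gen g * Poly_Mapping.single (Word ws) 1"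
    by (simp add: gen_def mult_single plus_free_monoid_def)
  then have "residue S' (Poly_Mapping.single (Word (g # ws)) 1) =
      residue S' (gen g * (poly_at f z * B.xpow n))"
    using residue_mult_cong[OF refl IH, of "gen g"] by simp
  then show ?case using gen_poly_B_basis[of g f n] by simp
qed

lemma B_normal_form: obtains F where "residue S' f = residue S' (poly_combination z B.xpow F)"
proof -
  have "\<exists>g n. residue S' (Poly_Mapping.single u 1) = residue S' (poly_at g z * B.xpow n)" for u
    using B_normal_form_word[of "letters u"] by simp
  then show thesis
    using residue_poly_combination[of f S' z B.xpow] that by blast
qed

text \<open>The factor \<open>q\<^sub>+\<^sup>k\<close> compensates for moving \<open>x\<^sub>+\<close> past \<open>z\<^sub>+\<^sup>k\<close> in the product of the images of
  \<open>y\<close> and \<open>x\<close>, which has to be \<open>p(w)\<close> exactly.\<close>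

primrec B_image :: "B_gen \<Rightarrow> (A_gen, 'k) free_algebra" where
  "B_image Bx = const (qp ^ k) * (zp ^ k * xm)"
| "B_image By = zm ^ k * xp"
| "B_image Bz = w"

sublocale B_image: substitution B_image .

abbreviation "\<psi> \<equiv> substitute B_image"

lemma psi_homogeneous: "\<psi> f \<in> homogeneous wt 0"
proof -
  have gens: "B_image g \<in> homogeneous wt 0" for g
  proof (cases g)
    case Bx
    have "zp ^ k * xm \<in> homogeneous wt (int k * 1 + - int k)"
      by (intro homogeneous_mult homogeneous_power homogeneous_gen) simp_all
    with Bx show ?thesis by (simp add: homogeneous_scale)
  next
    case By
    have "zm ^ k * xp \<in> homogeneous wt (int k * (- 1) + int k)"
      by (intro homogeneous_mult homogeneous_power homogeneous_gen) simp_all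
    with By show ?thesis by simp
  next
    case Bz
    have "w \<in> homogeneous wt (1 + - 1)"
      by (intro homogeneous_mult homogeneous_gen) simp_all
    with Bz show ?thesis by simp
  qed
  have word: "foldr (\<lambda>g v. B_image g * v) ws 1 \<in> homogeneous wt 0" for ws
  proof (induction ws)
    case (Cons g ws)
    from homogeneous_mult[OF gens this] show ?case by simp
  qed (simp add: homogeneous_one)
  have "B_image.act f 1 \<in> homogeneous wt 0"
    by (induction f rule: free_algebra_induct)
      (simp_all add: homogeneous_zero B_image.act_add B_image.act_single homogeneous_add
        homogeneous_scale word)
  then show ?thesis by (simp add: B_image.act_eq)
qed

lemma p_at: "poly_at p f = f ^ k * poly_at P f"
  by (subst p_eq) (simp only: poly_at_mult poly_at_power poly_at_X)

lemma psi_relation: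
  assumes "s \<in> S'" shows "\<psi> s \<in> relation_ideal S"
proof -
  note subst = B_image.substitute_mult B_image.substitute_gen B_image.substitute_const
    B_image.substitute_poly_at B_image.substitute_minus B_image.substitute_add
  have image_yx: "residue S (B_image By * B_image Bx) = residue S (poly_at p w)"
  proof -
    have "B_image By * B_image Bx = const (qp ^ k) * zm ^ k * ((xp * zp ^ k) * xm)"
      by (simp add: mult.assoc mult_const_left_commute[of "zm ^ k"] mult_const_left_commute[of xp])
    also have "residue S \<dots> =
        residue S (const (qp ^ k) * zm ^ k * ((const (inverse qp ^ k) * (zp ^ k * xp)) * xm))"
      by (intro residue_mult_cong[OF refl] residue_mult_cong[OF _ refl]
          q_commuteD q_commute_power_right q_commute_gens)
    also have "const (qp ^ k) * zm ^ k * ((const (inverse qp ^ k) * (zp ^ k * xp)) * xm) =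
        const (qp ^ k) * (const (inverse (qp ^ k)) * ((zm ^ k * zp ^ k) * (xp * xm)))"
      by (simp add: mult.assoc mult_const_left_commute[of "zm ^ k"] power_inverse)
    also have "\<dots> = (zm ^ k * zp ^ k) * (xp * xm)"
      using qp by (intro const_mult_inverse_cancel) simp
    also have "residue S \<dots> = residue S ((zp ^ k * zm ^ k) * poly_at P w)"
    proof (rule residue_mult_cong[OF _ xy])
      have "q_commute S 1 (zm ^ k) (zp ^ k)"
        using q_commute_power_left[OF q_commute_power_right[OF q_commute_gens(2), of k], of k] by simp
      then show "residue S (zm ^ k * zp ^ k) = residue S (zp ^ k * zm ^ k)"
        using q_commuteD by (simp add: q_commute_def const_simps)
    qed
    also have "\<dots> = residue S (w ^ k * poly_at P w)"
      by (rule residue_mult_cong[OF w_power refl])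
    finally show ?thesis by (simp only: p_at)
  qed
  have image_xy: "residue S (B_image Bx * B_image By) = residue S (poly_at p (const q * w))"
  proof -
    have "B_image Bx * B_image By = const (qp ^ k) * zp ^ k * ((xm * zm ^ k) * xp)"
      by (simp add: mult.assoc)
    also have "residue S \<dots> =
        residue S (const (qp ^ k) * zp ^ k * ((const (qm ^ k) * (zm ^ k * xm)) * xp))"
      by (intro residue_mult_cong[OF refl] residue_mult_cong[OF _ refl]
          q_commuteD q_commute_power_right q_commute_gens)
    also have "const (qp ^ k) * zp ^ k * ((const (qm ^ k) * (zm ^ k * xm)) * xp) =
        const (q ^ k) * ((zp ^ k * zm ^ k) * (xm * xp))"
      by (simp only: q_def power_mult_distrib const_simps(4) mult.assoc
          mult_const_left_commute[of "zp ^ k"])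
    also have "residue S \<dots> = residue S (const (q ^ k) * (w ^ k * poly_at P (const q * w)))"
      by (rule residue_mult_cong[OF refl residue_mult_cong[OF w_power yx]])
    also have "const (q ^ k) * (w ^ k * poly_at P (const q * w)) = poly_at p (const q * w)"
      by (simp only: p_at const_mult_power mult.assoc)
    finally show ?thesis .
  qed
  have const_w: "q_commute S 1 (const c) w" for c
    unfolding q_commute_def const_simps mult_1 by (rule arg_cong[OF const_commute])
  from q_commute_mult_left[OF const_w[of "qp ^ k"]
      q_commute_mult_left[OF q_commute_power_left[OF q_commute_w(1), of k] q_commute_w(4)]]
  have image_xz: "residue S (B_image Bx * w) = residue S (const q * (w * B_image Bx))"
    by (simp add: q_commute_def)
  from q_commute_mult_left[OF q_commute_power_left[OF q_commute_w(2), of k] q_commute_w(3)]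
  have image_yz: "residue S (B_image By * w) = residue S (const (inverse q) * (w * B_image By))"
    by (simp add: q_commute_def)
  from assms show ?thesis
    unfolding B_relations_def Let_def
    by (elim insertE emptyE; hypsubst)
      (simp_all only: subst const_simps(1) add_0_right diff_zero residue_eq_iff[symmetric] mult.assoc
        B_image.simps(3) image_yx image_xy image_xz image_yz)
qed

text \<open>The normal forms of \<open>\<B>(p; q, 0)\<close> go to those of degree \<open>0\<close> in \<open>\<A>(p; q\<^sub>\<plusminus>)\<close>, up to scalars.
  Hence the homomorphism is onto the degree-zero part, and it is injective because the latter are
  independent.\<close>

lemma psi_basis: "\<exists>c. c \<noteq> 0 \<and> residue S (\<psi> (B.xpow n)) = residue S (const c * A_basis 0 n)"
proof (cases "n \<ge> 0")
  case True
  obtain c where "c \<noteq> 0"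
    "residue S ((zm ^ k * xp) ^ nat n) = residue S (const c * ((zm ^ k) ^ nat n * xp ^ nat n))"
    using residue_power_q_commute[OF q_commute_power_right[OF q_commute_gens(4), of k], of "nat n"]
      qm by auto
  moreover have "(zm ^ k) ^ nat n = zm ^ nat (n * int k)" "nat (- (n * int k)) = 0"
    using True by (simp_all add: power_mult[symmetric] nat_mult_distrib mult.commute)
  ultimately show ?thesis
    using True
    by (auto simp: B.xpow_def xpow_def A_basis_def B_image.substitute_power
        B_image.substitute_gen intro!: exI[of _ c])
next
  case False
  let ?m = "nat (- n)"
  obtain c where c: "c \<noteq> 0"
    "residue S ((zp ^ k * xm) ^ ?m) = residue S (const c * ((zp ^ k) ^ ?m * xm ^ ?m))"
    using residue_power_q_commute[OF q_commute_power_right[OF q_commute_gens(5), of k], of ?m]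
      qp by auto
  have "(zp ^ k) ^ ?m = zp ^ nat (- (n * int k))" "nat (n * int k) = 0"
    using False nat_mult_distrib[of "- n" "int k"]
    by (simp_all add: power_mult[symmetric] mult.commute mult_le_0_iff)
  then have basis: "A_basis 0 n = (zp ^ k) ^ ?m * xm ^ ?m"
    using False by (simp add: A_basis_def xpow_def)
  have "residue S (\<psi> (B.xpow n)) = residue S (const ((qp ^ k) ^ ?m) * (zp ^ k * xm) ^ ?m)"
    using False
    by (simp only: B.xpow_def B_image.substitute_power B_image.substitute_gen B_image.simps
        const_mult_power if_False)
  also have "\<dots> = residue S (const ((qp ^ k) ^ ?m) * (const c * ((zp ^ k) ^ ?m * xm ^ ?m)))"
    by (rule residue_mult_cong[OF refl c(2)])
  also have "\<dots> = residue S (const ((qp ^ k) ^ ?m * c) * A_basis 0 n)"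
    by (simp only: basis const_simps(4) mult.assoc)
  finally show ?thesis using c(1) qp by (intro exI[of _ "(qp ^ k) ^ ?m * c"]) simp
qed

lemma psi_surj:
  assumes "f \<in> homogeneous wt 0"
  obtains g where "residue S (\<psi> g) = residue S f"
proof -
  obtain c where c: "\<And>n. c n \<noteq> 0"
    "\<And>n. residue S (\<psi> (B.xpow n)) = residue S (const (c n) * A_basis 0 n)"
    using psi_basis by metis
  obtain F where F: "residue S f = residue S (poly_combination w (A_basis 0) F)"
    using A_normal_form[OF assms] .
  let ?g = "\<Sum>n\<in>Poly_Mapping.keys F. poly_at (Poly_Mapping.lookup F n) z *
    (const (inverse (c n)) * B.xpow n)"
  have "residue S (poly_at h w * (const (inverse (c n)) * \<psi> (B.xpow n))) =
      residue S (poly_at h w * A_basis 0 n)" for h n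
  proof -
    have "const (inverse (c n)) * (const (c n) * A_basis 0 n) = A_basis 0 n"
      using c(1)[of n] by (simp add: const_mult_eq_1 flip: mult.assoc)
    then show ?thesis
      using residue_mult_cong[OF refl[of "residue S (poly_at h w * const (inverse (c n)))"] c(2)[of n]]
      by (simp add: mult.assoc)
  qed
  then have "residue S (\<psi> ?g) = residue S f"
    unfolding F poly_combination_def B_image.substitute_sum
    by (intro residue_sum_cong)
      (simp add: B_image.substitute_mult B_image.substitute_poly_at B_image.substitute_gen
        B_image.substitute_const)
  then show thesis by (rule that)
qed

lemma psi_inj:
  assumes "\<psi> f \<in> relation_ideal S" shows "f \<in> relation_ideal S'"
proof -
  obtain c where c: "\<And>n. c n \<noteq> 0"
    "\<And>n. residue S (\<psi> (B.xpow n)) = residue S (const (c n) * A_basis 0 n)"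
    using psi_basis by metis
  obtain F where F: "residue S' f = residue S' (poly_combination z B.xpow F)"
    using B_normal_form .
  let ?G = "\<Sum>n\<in>Poly_Mapping.keys F.
    Poly_Mapping.single n (Polynomial.smult (c n) (Poly_Mapping.lookup F n))"
  have "\<psi> (f - poly_combination z B.xpow F) \<in> relation_ideal S"
    using F by (intro B_image.substitute_relation_ideal[OF psi_relation]) (simp_all add: residue_eq_iff)
  then have "residue S (\<psi> (poly_combination z B.xpow F)) = residue S (\<psi> f)"
    by (simp add: B_image.substitute_minus residue_eq_iff[symmetric])
  also have "\<dots> = residue S 0" using assms by (simp add: residue_eq_iff)
  also have "residue S (\<psi> (poly_combination z B.xpow F)) = residue S
      (\<Sum>n\<in>Poly_Mapping.keys F. poly_at (Poly_Mapping.lookup F n) w * \<psi> (B.xpow n))"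
    by (simp add: poly_combination_def B_image.substitute_sum B_image.substitute_mult
        B_image.substitute_poly_at B_image.substitute_gen)
  also have "\<dots> = residue S
      (\<Sum>n\<in>Poly_Mapping.keys F. poly_at (Poly_Mapping.lookup F n) w * (const (c n) * A_basis 0 n))"
    by (intro residue_sum_cong residue_mult_cong[OF refl c(2)])
  also have "\<dots> = residue S (poly_combination w (A_basis 0) ?G)"
    by (simp add: poly_combination_sum poly_combination_single poly_at_smult mult.assoc
        mult_const_left_commute[of "poly_at _ _"])
  finally have "?G = 0" by (rule A_basis_independent)
  have "Poly_Mapping.lookup F n = 0" for n
  proof (rule ccontr)
    assume n: "Poly_Mapping.lookup F n \<noteq> 0"
    have "Poly_Mapping.lookup ?G n = Polynomial.smult (c n) (Poly_Mapping.lookup F n)"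
      using n by (simp add: lookup_sum lookup_single when_def in_keys_iff sum.delta')
    with \<open>?G = 0\<close> n c(1)[of n] show False by simp
  qed
  then have "F = 0" by (intro poly_mapping_eqI) simp
  then show ?thesis
    using F by (simp add: poly_combination_def residue_eq_iff)
qed

end

section \<open>The Veronese subalgebra is strongly graded\<close>

text \<open>\<open>1 - Q/Q(0)\<close> is a multiple of the variable, so its \<open>N\<close>-th power is a multiple of the \<open>N\<close>-th
  power of the variable; by the geometric sum it is also congruent to \<open>1\<close> modulo \<open>Q\<close>.\<close>

lemma power_X_Bezout:
  fixes Q :: "'k::field poly"
  assumes "poly Q 0 \<noteq> 0"
  obtains U V where "U * Q + V * [:0, 1:] ^ N = 1"
proof -
  define x where "x = 1 - Polynomial.smult (inverse (poly Q 0)) Q"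
  have "poly x 0 = 0" using assms by (simp add: x_def)
  then have "[:0, 1:] dvd x" by (simp add: dvd_iff_poly_eq_0)
  then obtain R where R: "x = [:0, 1:] * R" by blast
  have "1 - x ^ N = Polynomial.smult (inverse (poly Q 0)) Q * (\<Sum>i<N. x ^ i)"
    by (simp add: one_diff_power_eq x_def)
  then have "Polynomial.smult (inverse (poly Q 0)) (\<Sum>i<N. x ^ i) * Q + R ^ N * [:0, 1:] ^ N = 1"
    unfolding R by (simp add: power_mult_distrib[symmetric] mult.commute algebra_simps)
  then show thesis by (rule that)
qed

context A_parameters
begin

abbreviation "V \<equiv> A_veronese k p qp qm"
abbreviation "G \<equiv> A_veronese_component k p qp qm"

lemma V_eq: "V = residue_algebra S (veronese_span wt k)"
  unfolding A_veronese_def A_algebra_def A_component_def k_def[symmetric]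
  using k_pos by (rule veronese_algebra_presented)

lemma G_eq: "G n = residue S ` homogeneous wt (n * int k)"
  by (simp add: A_veronese_component_def veronese_component_def A_component_def
      presented_component_eq k_def)

lemma V_simps:
  "residue S f \<otimes>\<^bsub>V\<^esub> residue S g = residue S (f * g)"
  "residue S f \<oplus>\<^bsub>V\<^esub> residue S g = residue S (f + g)"
  "\<one>\<^bsub>V\<^esub> = residue S 1"
  "\<zero>\<^bsub>V\<^esub> = residue S 0"
  by (simp_all add: V_eq presented_algebra_simps)

lemma graded_algebra_V: "graded_algebra ring_of_type_algebra V G"
  unfolding A_veronese_def A_algebra_def A_veronese_component_def A_component_def k_def[symmetric]
  using k_pos homogeneous_A_relations by (rule graded_algebra_veronese)

lemma homogeneous_w: "w \<in> homogeneous wt 0"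
proof -
  have "w \<in> homogeneous wt (1 + - 1)"
    by (intro homogeneous_mult homogeneous_gen) simp_all
  then show ?thesis by simp
qed

text \<open>A Bezout identity between \<open>Q\<close> and the \<open>N\<close>-th power of the variable, evaluated at \<open>w\<close>; the
  cofactors have degree \<open>0\<close> and are absorbed into \<open>a\<close> and \<open>a'\<close>.\<close>

lemma unit_partition:
  assumes ab: "residue S (a * b) = residue S (poly_at Q w)" "poly Q 0 \<noteq> 0"
    and ab': "residue S (a' * b') = residue S (w ^ N)"
    and a: "a \<in> homogeneous wt (n * int k)" "a' \<in> homogeneous wt (n * int k)"
    and b: "b \<in> homogeneous wt (- n * int k)" "b' \<in> homogeneous wt (- n * int k)"
  shows "\<exists>a\<in>G n. \<exists>b\<in>G (- n). \<exists>a'\<in>G n. \<exists>b'\<in>G (- n).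
    \<one>\<^bsub>V\<^esub> = a \<otimes>\<^bsub>V\<^esub> b \<oplus>\<^bsub>V\<^esub> a' \<otimes>\<^bsub>V\<^esub> b'"
proof -
  obtain F H where FH: "F * Q + H * [:0, 1:] ^ N = 1" using power_X_Bezout[OF ab(2)] .
  have "residue S (poly_at F w * a * b + poly_at H w * a' * b') =
      residue S (poly_at F w * poly_at Q w + poly_at H w * w ^ N)"
    unfolding mult.assoc
    by (rule residue_add_cong[OF residue_mult_cong[OF refl ab(1)] residue_mult_cong[OF refl ab']])
  also have "poly_at F w * poly_at Q w + poly_at H w * w ^ N = poly_at 1 w"
    by (simp only: FH[symmetric] poly_at_add poly_at_mult poly_at_power poly_at_X)
  finally have eq: "\<one>\<^bsub>V\<^esub> = residue S (poly_at F w * a) \<otimes>\<^bsub>V\<^esub> residue S b \<oplus>\<^bsub>V\<^esub>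
      residue S (poly_at H w * a') \<otimes>\<^bsub>V\<^esub> residue S b'"
    by (simp add: V_simps)
  have "poly_at F w * a \<in> homogeneous wt (n * int k)" "poly_at H w * a' \<in> homogeneous wt (n * int k)"
    using homogeneous_mult[OF homogeneous_poly_at[OF homogeneous_w, of F] a(1)]
      homogeneous_mult[OF homogeneous_poly_at[OF homogeneous_w, of H] a(2)] by simp_all
  with b have mem: "residue S (poly_at F w * a) \<in> G n" "residue S (poly_at H w * a') \<in> G n"
    "residue S b \<in> G (- n)" "residue S b' \<in> G (- n)"
    by (simp_all add: G_eq)
  show ?thesis
    by (intro bexI[OF _ mem(1)] bexI[OF _ mem(2)] bexI[OF _ mem(3)] bexI[OF _ mem(4)] eq)
qed

text \<open>In degree \<open>n\<close> the two products are \<open>x\<^sub>+\<^sup>n x\<^sub>-\<^sup>n\<close> and \<open>z\<^sub>+\<^sup>n\<^sup>k z\<^sub>-\<^sup>n\<^sup>k\<close>; for negative degrees the roles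
  of plus and minus are exchanged.\<close>

lemma graded_partition_of_unity_V: "graded_partition_of_unity ring_of_type_algebra V G"
proof (intro graded_partition_of_unity.intro graded_partition_of_unity_axioms.intro graded_algebra_V)
  show "\<one>\<^bsub>V\<^esub> \<in> G 0" using homogeneous_one[of wt] by (auto simp: V_simps G_eq)
  fix n
  have gens: "zp \<in> homogeneous wt 1" "zm \<in> homogeneous wt (- 1)"
    "xp \<in> homogeneous wt (int k)" "xm \<in> homogeneous wt (- int k)"
    by (auto intro: homogeneous_gen)
  have pow: "zp ^ i \<in> homogeneous wt (int i)" "zm ^ i \<in> homogeneous wt (- int i)"
    "xp ^ i \<in> homogeneous wt (int i * int k)" "xm ^ i \<in> homogeneous wt (- int i * int k)" for i
    using gens[THEN homogeneous_power, of i] by simp_all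
  show "\<exists>a\<in>G n. \<exists>b\<in>G (- n). \<exists>a'\<in>G n. \<exists>b'\<in>G (- n).
    \<one>\<^bsub>V\<^esub> = a \<otimes>\<^bsub>V\<^esub> b \<oplus>\<^bsub>V\<^esub> a' \<otimes>\<^bsub>V\<^esub> b'"
  proof (cases "n \<ge> 0")
    case True
    define m where "m = nat n"
    have n: "n = int m" using True by (simp add: m_def)
    obtain Q where Q: "residue S (xp ^ m * xm ^ m) = residue S (poly_at Q w)" "poly Q 0 = poly P 0 ^ m"
      using x_power_y_power by blast
    show ?thesis
    proof (rule unit_partition[OF Q(1) _ w_power])
      show "poly Q 0 \<noteq> 0" using Q(2) P_0 by simp
      show "xp ^ m \<in> homogeneous wt (n * int k)" "xm ^ m \<in> homogeneous wt (- n * int k)"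
        "zp ^ (m * k) \<in> homogeneous wt (n * int k)" "zm ^ (m * k) \<in> homogeneous wt (- n * int k)"
        using pow(1,2)[of "m * k"] pow(3,4)[of m] by (simp_all add: n)
    qed
  next
    case False
    define m where "m = nat (- n)"
    have n: "n = - int m" using False by (simp add: m_def)
    interpret swap: weyl_relations S xm xp w "pcompose P [:0, q:]" "inverse q"
      by (rule weyl_relations_swap)
    obtain Q where Q: "residue S (xm ^ m * xp ^ m) = residue S (poly_at Q w)"
      "poly Q 0 = poly (pcompose P [:0, q:]) 0 ^ m"
      using swap.x_power_y_power by blast
    have "q_commute S 1 (zm ^ (m * k)) (zp ^ (m * k))"
      using q_commute_power_left[OF q_commute_power_right[OF q_commute_gens(2), of "m * k"], of "m * k"]
      by simp
    then have z: "residue S (zm ^ (m * k) * zp ^ (m * k)) = residue S (w ^ (m * k))"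
      by (simp add: q_commute_def const_simps w_power)
    show ?thesis
    proof (rule unit_partition[OF Q(1) _ z])
      show "poly Q 0 \<noteq> 0" using Q(2) P_0 by (simp add: poly_pcompose)
      show "xm ^ m \<in> homogeneous wt (n * int k)" "xp ^ m \<in> homogeneous wt (- n * int k)"
        "zm ^ (m * k) \<in> homogeneous wt (n * int k)" "zp ^ (m * k) \<in> homogeneous wt (- n * int k)"
        using pow(1,2)[of "m * k"] pow(3,4)[of m] by (simp_all add: n)
    qed
  qed
qed

sublocale V: graded_partition_of_unity ring_of_type_algebra V G
  by (rule graded_partition_of_unity_V)

lemma degree_zero_part_V: "degree_zero_part V G = residue_algebra S (homogeneous wt 0)"
  by (simp add: degree_zero_part_def V_eq G_eq)

lemma degree_zero_part_isomorphic:
  "algebra_isomorphic ring_of_type_algebra (degree_zero_part V G) (B_algebra p q 0)"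
proof -
  let ?A = "degree_zero_part V G" and ?B = "B_algebra p q 0"
  have ring_B: "ring ?B"
    using unital_algebra_presented_algebra[of S'] by (simp add: B_algebra_def unital_algebra_def)
  (* The homomorphism on residues, defined through representatives; the choice does not matter. *)
  define h where "h b = residue S (\<psi> (SOME f. residue S' f = b))" for b
  have psi_cong: "residue S (\<psi> f) = residue S (\<psi> g) \<longleftrightarrow> residue S' f = residue S' g" for f g
    using psi_inj[of "f - g"] B_image.substitute_relation_ideal[where f = "f - g", OF psi_relation]
    by (auto simp: residue_eq_iff B_image.substitute_minus)
  have h: "h (residue S' f) = residue S (\<psi> f)" for f
    unfolding h_def psi_cong by (rule someI) (rule refl)
  have B_simps: "carrier ?B = range (residue S')" "\<one>\<^bsub>?B\<^esub> = residue S' 1"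
    "residue S' f \<otimes>\<^bsub>?B\<^esub> residue S' g = residue S' (f * g)"
    "residue S' f \<oplus>\<^bsub>?B\<^esub> residue S' g = residue S' (f + g)"
    "c \<odot>\<^bsub>?B\<^esub> residue S' f = residue S' (const c * f)" for c f g
    by (simp_all add: B_algebra_def presented_algebra_simps)
  have "residue S f \<in> range (\<lambda>g. residue S (\<psi> g))" if "f \<in> homogeneous wt 0" for f
    using psi_surj[OF that] by (metis rangeI)
  then have "bij_betw h (carrier ?B) (carrier ?A)"
    by (auto simp: bij_betw_def inj_on_def B_simps h psi_cong degree_zero_part_V psi_homogeneous
        image_image)
  moreover have "h \<in> ring_hom ?B ?A"
    by (rule ring_hom_memI)
      (auto simp: B_simps h degree_zero_part_V presented_algebra_simps psi_homogeneous
        B_image.substitute_add B_image.substitute_mult B_image.substitute_one)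
  ultimately have iso: "h \<in> ring_iso ?B ?A" by (simp add: ring_iso_def)
  let ?g = "inv_into (carrier ?B) h"
  have smult: "?g (c \<odot>\<^bsub>?A\<^esub> a) = c \<odot>\<^bsub>?B\<^esub> ?g a" if a: "a \<in> carrier ?A" for c a
  proof -
    have inj: "inj_on h (carrier ?B)" and surj: "h ` carrier ?B = carrier ?A"
      using iso by (auto simp: ring_iso_def bij_betw_def)
    then obtain f where f: "a = h (residue S' f)" using a by (auto simp: B_simps)
    have "c \<odot>\<^bsub>?A\<^esub> a = h (c \<odot>\<^bsub>?B\<^esub> residue S' f)"
      by (simp add: f B_simps h degree_zero_part_V presented_algebra_simps
          B_image.substitute_mult B_image.substitute_const)
    then show ?thesis using inj by (simp add: f B_simps)
  qed
  show ?thesis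
    unfolding algebra_isomorphic_def
    using ring_iso_set_sym[OF ring_B iso] smult by blast
qed

section \<open>Non-degeneracy\<close>

lemma has_nonzero_root_iff: "has_nonzero_root p \<longleftrightarrow> Polynomial.degree P > 0"
proof -
  let ?m = "map_poly to_ac :: 'k poly \<Rightarrow> 'k alg_closure poly"
  have "?m ([:0, 1:] ^ n) = [:0, 1:] ^ n" for n
    by (induction n) (simp_all only: power_0 power_Suc map_poly_to_ac_mult map_poly_to_ac_1,
        simp add: map_poly_pCons)
  then have p: "?m p = [:0, 1:] ^ k * ?m P"
    by (subst p_eq) (simp only: map_poly_to_ac_mult)
  have degree: "Polynomial.degree (?m P) = Polynomial.degree P"
    by (rule degree_map_poly) simp
  have at_0: "poly (?m P) 0 \<noteq> 0"
    using poly_map_poly_to_ac[of P 0] P_0 by simp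
  show ?thesis
  proof
    assume "has_nonzero_root p"
    then obtain a where a: "a \<noteq> 0" "poly (?m P) a = 0"
      by (auto simp: has_nonzero_root_def p)
    show "Polynomial.degree P > 0"
    proof (rule ccontr)
      assume "\<not> Polynomial.degree P > 0"
      then have "Polynomial.degree (?m P) = 0" using degree by simp
      then obtain c where "?m P = [:c:]" by (rule degree_eq_zeroE)
      with a at_0 show False by simp
    qed
  next
    assume "Polynomial.degree P > 0"
    then obtain a where "poly (?m P) a = 0"
      using alg_closed_imp_poly_has_root[of "?m P"] degree by auto
    with at_0 show "has_nonzero_root p"
      by (auto simp: has_nonzero_root_def p intro!: exI[of _ a])
  qed
qed

lemma components_not_isomorphic:
  assumes P: "Polynomial.degree P > 0"
    and iso: "left_module_isomorphic (degree_zero_part V G) (component_module V G m)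
      (component_module V G n)"
  shows "m = n"
proof -
  obtain a b where ab: "a \<in> G (n - m)" "b \<in> G (m - n)" "a \<otimes>\<^bsub>V\<^esub> b = \<one>\<^bsub>V\<^esub>"
    using V.component_iso_imp_unit[OF iso] .
  then obtain u v where u: "u \<in> homogeneous wt ((n - m) * int k)" "a = residue S u"
    and v: "v \<in> homogeneous wt ((m - n) * int k)" "b = residue S v" by (auto simp: G_eq)
  have "residue S (u * v) = residue S 1" using ab(3) by (simp add: u(2) v(2) V_simps)
  moreover have "v \<in> homogeneous wt (- ((n - m) * int k))"
    using v(1) by (simp add: algebra_simps)
  ultimately have "(n - m) * int k = 0" using homogeneous_unit_degree[OF u(1) _ _ P] by blast
  then show ?thesis using k_pos by simp
qed

text \<open>If \<open>P\<close> is a constant \<open>c\<close>, then \<open>x\<^sub>+x\<^sub>- = x\<^sub>-x\<^sub>+ = c\<close>, so \<open>x\<^sub>+\<close> is a unit of degree \<open>k\<close>, which is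
  degree \<open>1\<close> in the Veronese grading.\<close>

lemma components_isomorphic:
  assumes P: "Polynomial.degree P = 0"
  shows "left_module_isomorphic (degree_zero_part V G) (component_module V G 0)
    (component_module V G 1)"
proof -
  obtain c where c: "P = [:c:]" using P by (rule degree_eq_zeroE)
  have "c \<noteq> 0" using P_0 c by simp
  have inverse: "residue S (const (inverse c) * f) = residue S 1"
    if "residue S f = residue S (const c)" for f
    using residue_mult_cong[OF refl that, of "const (inverse c)"] \<open>c \<noteq> 0\<close>
    by (simp add: const_mult_eq_1)
  show ?thesis
  proof (rule V.unit_imp_component_iso)
    show "residue S xp \<in> G 1" "residue S (const (inverse c) * xm) \<in> G (- 1)"
      by (auto simp: G_eq intro!: homogeneous_scale homogeneous_gen)
    show "residue S xp \<otimes>\<^bsub>V\<^esub> residue S (const (inverse c) * xm) = \<one>\<^bsub>V\<^esub>"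
      using inverse[of "xp * xm"] xy by (simp add: V_simps c poly_at_const mult_const_left_commute[of xp])
    show "residue S (const (inverse c) * xm) \<otimes>\<^bsub>V\<^esub> residue S xp = \<one>\<^bsub>V\<^esub>"
      using inverse[of "xm * xp"] yx by (simp add: V_simps c poly_at_const mult.assoc)
  qed
qed

lemma nondegenerate_iff:
  "nondegenerate_projectively_graded_algebra ring_of_type_algebra V G \<longleftrightarrow> has_nonzero_root p"
proof
  assume "nondegenerate_projectively_graded_algebra ring_of_type_algebra V G"
  then have "\<not> left_module_isomorphic (degree_zero_part V G) (component_module V G 0)
      (component_module V G 1)"
    by (simp add: nondegenerate_projectively_graded_algebra_def)
  with components_isomorphic show "has_nonzero_root p"
    by (auto simp: has_nonzero_root_iff)
next
  assume "has_nonzero_root p"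
  then have "Polynomial.degree P > 0" by (simp add: has_nonzero_root_iff)
  with components_not_isomorphic
  show "nondegenerate_projectively_graded_algebra ring_of_type_algebra V G"
    unfolding nondegenerate_projectively_graded_algebra_def projectively_graded_algebra_def
    using graded_algebra_V V.projective_component V.finitely_generated_component by blast
qed

end

theorem theorem3p7:
  fixes p :: "'k::field_char_0 poly" and qp qm q :: 'k and k :: nat
  assumes "qp \<noteq> 0" and "qm \<noteq> 0" and "q = qp * qm"
    and "p \<noteq> 0" and "poly p 0 = 0" and "k = Polynomial.order 0 p"
  shows "(strongly_graded_algebra ring_of_type_algebra
            (A_veronese k p qp qm) (A_veronese_component k p qp qm) \<and>
          algebra_isomorphic ring_of_type_algebra
            (degree_zero_part (A_veronese k p qp qm) (A_veronese_component k p qp qm))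
            (B_algebra p q 0)) \<and>
         ((\<forall>n>0. q ^ n \<noteq> 1) \<longrightarrow>
           (nondegenerate_projectively_graded_algebra ring_of_type_algebra
              (A_veronese k p qp qm) (A_veronese_component k p qp qm)
            \<longleftrightarrow> has_nonzero_root p))"
proof -
  interpret A_parameters p qp qm q k
    using assms by unfold_locales
  show ?thesis
    using V.strongly_graded degree_zero_part_isomorphic nondegenerate_iff by blast
qed

end
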